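(* Let $\mathcal{F}=\{f_i:i\in I\}$, $I=\{1,\ldots,k\}$, be an iterated function system of similarities on a Euclidean space $\mathbb{R}^d$ satisfying the open set condition, and let $K$ be its attractor. Let $c_i\in(0,1)$ be the similarity factor of $f_i$ for each $i\in I$, and let $\mathbf{\Gamma}$ be the natural fractal structure on $K$ as a self-similar set. Let $s$ be given by $$\sum_{i\in I}c_i^s=1.$$ Then the following two statements hold: (1) $\dim_B(K)=\dim_{\mathbf{\Gamma}}^3(K)=\dim_{\mathbf{\Gamma}}^4(K)=\dim_{\mathbf{\Gamma}}^5(K)=\dim_{\mathbf{\Gamma}}^6(K)=\dim_H(K)=s$. (2) If all the similarity factors are equal, namely $c_i=c\in(0,1)$ for each $i\in I$, then $$\dim_B(K)=\dim_{\mathbf{\Gamma}}^2(K)=\dim_{\mathbf{\Gamma}}^3(K)=\dim_{\mathbf{\Gamma}}^4(K)=\dim_{\mathbf{\Gamma}}^5(K)=\dim_{\mathbf{\Gamma}}^6(K)=\dim_H(K)\leq\gamma_c\cdot\dim_{\mathbf{\Gamma}}^1(K),$$ where $\gamma_c=-\log2/\log c$. Moreover, for that value of $s$, $\mathcal{H}_H^s(K)\in(0,\infty)$ and $\mathcal{H}_m^s(K)\in(0,\infty)$ for $m=3,4,5,6$.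
   Context: A similarity on a metric space $(X,\rho)$ with similarity factor $c>0$ is a map $f:X\to X$ with $\rho(f(x),f(y))=c\,\rho(x,y)$ for all $x,y\in X$. An iterated function system (IFS) is a finite family $\mathcal{F}=\{f_i:i\in I\}$, $I=\{1,\ldots,k\}$, of (contractive) similarities; it is Euclidean if $X=\mathbb{R}^d$. Its attractor (self-similar set) is the unique non-empty compact set $K\subset X$ with $K=\bigcup_{i\in I}f_i(K)$. Open set condition: there is a non-empty bounded open set $V\subset\mathbb{R}^d$ such that $\bigcup_{i\in I}f_i(V)\subset V$ with this union disjoint. A fractal structure on a set $X$ is a countable family $\mathbf{\Gamma}=\{\Gamma_n:n\in\mathbb{N}\}$ of coverings of $X$ (called levels) such that for all $n$: every $A\in\Gamma_{n+1}$ is contained in some $B\in\Gamma_n$, and every $B\in\Gamma_n$ satisfies $B=\bigcup\{A\in\Gamma_{n+1}:A\subseteq B\}$. A set is allowed to appear more than once in a level (levels are families counted with multiplicity). The natural fractal structure on the attractor $K$ has levels $\Gamma_n=\{f_\omega(K):\omega\in I^n\}$, where $f_\omega=f_{\omega_1}\circ\cdots\circ f_{\omega_n}$ for $\omega=\omega_1\ldots\omega_n$; the family is indexed by words $\omega\in I^n$, so it is counted with multiplicity. Box dimension of $F\subseteq\mathbb{R}^d$: $\dim_B(F)=\lim_{\delta\to0}\frac{\log N_\delta(F)}{-\log\delta}$, where $N_\delta(F)$ is the largest number of disjoint balls of radius $\delta$ with centres in $F$. $\dim_H$ is the usual Hausdorff dimension, defined from the Hausdorff measures $\mathcal{H}_H^s(F)=\lim_{\delta\to0}\inf\{\sum_j\operatorname{diam}(U_j)^s\}$,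 the infimum being over countable covers $\{U_j\}$ of $F$ with $\operatorname{diam}(U_j)\le\delta$ for all $j$. Let $\mathbf{\Gamma}$ be a fractal structure on a metric space $(X,\rho)$ and $F\subseteq X$. Let $N_n(F)$ be the number of elements of $\Gamma_n$ that intersect $F$ (with multiplicity) and $\delta(F,\Gamma_n)=\sup\{\operatorname{diam}(A):A\in\Gamma_n,\ A\cap F\neq\emptyset\}$. Fractal dimension I: $\dim_{\mathbf{\Gamma}}^1(F)=\lim_{n\to\infty}\frac{\log N_n(F)}{n\log2}$. Fractal dimension II: $\dim_{\mathbf{\Gamma}}^2(F)=\lim_{n\to\infty}\frac{\log N_n(F)}{-\log\delta(F,\Gamma_n)}$. For the box dimension and fractal dimensions I and II, lower/upper versions use lower/upper limits; the unqualified symbol means that the limit exists. Fractal dimensions III, IV, V (assuming $\delta(F,\Gamma_n)\to0$): for $m\in\{3,4,5\}$, $n\in\mathbb{N}$, $s\ge0$, $$\mathcal{H}_{n,m}^s(F)=\inf\Big\{\sum_{j\in J}\operatorname{diam}(A_j)^s:\{A_j\}_{j\in J}\in\mathcal{A}_{n,m}(F)\Big\},\qquad \mathcal{H}_m^s(F)=\lim_{n\to\infty}\mathcal{H}_{n,m}^s(F),$$ where $\mathcal{A}_{n,3}(F)=\{\{A\in\Gamma_l:A\cap F\neq\emptyset\}:l\geq n\}$ (with multiplicity); $\mathcal{A}_{n,4}(F)=\{\{A_j\}_{j\in J}:A_j\in\bigcup_{l\geq n}\Gamma_l\ \forall j\in J,\ F\subseteq\bigcup_{j\in J}A_j,\ |J|<\infty\}$;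 $\mathcal{A}_{n,5}(F)=\{\{A_j\}_{j\in J}:A_j\in\bigcup_{l\geq n}\Gamma_l\ \forall j\in J,\ F\subseteq\bigcup_{j\in J}A_j\}$. Fractal dimension VI (assuming $\delta(F,\Gamma_n)\to0$): for $\delta>0$, $\mathcal{H}_{\delta,6}^s(F)=\inf\{\sum_{j\in J}\operatorname{diam}(A_j)^s:\{A_j\}_{j\in J}\in\mathcal{A}_{\delta,6}(F)\}$, where $\mathcal{A}_{\delta,6}(F)=\{\{A_j\}_{j\in J}:A_j\in\bigcup_{l\in\mathbb{N}}\Gamma_l,\ \operatorname{diam}(A_j)\leq\delta\ \forall j\in J,\ F\subseteq\bigcup_{j\in J}A_j\}$, and $\mathcal{H}_6^s(F)=\lim_{\delta\to0}\mathcal{H}_{\delta,6}^s(F)$. For $m\in\{3,4,5,6\}$: $\dim_{\mathbf{\Gamma}}^m(F)=\inf\{s:\mathcal{H}_m^s(F)=0\}=\sup\{s:\mathcal{H}_m^s(F)=\infty\}$. *)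

theory Defs
  imports "HOL-Analysis.Analysis"
begin

section \<open>Extended-real conventions\<close>

text \<open>The library constant \<^const>\<open>diameter\<close> is unspecified on unbounded sets.\<close>

definition ediam :: "'a::metric_space set \<Rightarrow> ennreal" where
  "ediam A = (if bounded A then ennreal (diameter A) else \<infinity>)"

text \<open>Powers with exponent \<open>s \<ge> 0\<close> and \<open>0\<^sup>0 = 1\<close>, so that the measures below count sets
  for \<open>s = 0\<close> (note that \<open>0 powr 0 = 0\<close> in the library). This matters when the attractor is a
  single point.\<close>

definition epower :: "ennreal \<Rightarrow> real \<Rightarrow> ennreal" where
  "epower x s = (if s = 0 then 1 else if x = \<infinity> then \<infinity> else ennreal (enn2real x powr s))"

definition eln :: "ennreal \<Rightarrow> ereal" where
  "eln x = (if x = 0 then -\<infinity> else if x = \<infinity> then \<infinity> else ereal (ln (enn2real x)))"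

definition ecount :: "'a set \<Rightarrow> ennreal" where
  "ecount S = (if finite S then of_nat (card S) else \<infinity>)"


section \<open>Self-similar sets\<close>

definition similarity :: "real \<Rightarrow> ('a::metric_space \<Rightarrow> 'a) \<Rightarrow> bool" where
  "similarity c f \<longleftrightarrow> c > 0 \<and> (\<forall>x y. dist (f x) (f y) = c * dist x y)"

text \<open>For contractions such a set exists and is unique (Hutchinson).\<close>

definition is_attractor :: "'i set \<Rightarrow> ('i \<Rightarrow> 'a \<Rightarrow> 'a::metric_space) \<Rightarrow> 'a set \<Rightarrow> bool" where
  "is_attractor I f K \<longleftrightarrow> K \<noteq> {} \<and> compact K \<and> K = (\<Union>i\<in>I. f i ` K)"

text \<open>Disjointness is understood for the family indexed by \<open>I\<close>: \<open>f i ` V\<close> and \<open>f j ` V\<close> are disjoint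
  whenever \<open>i \<noteq> j\<close>, even if \<open>f i = f j\<close>.\<close>

definition open_set_condition :: "'i set \<Rightarrow> ('i \<Rightarrow> 'a \<Rightarrow> 'a::metric_space) \<Rightarrow> bool" where
  "open_set_condition I f \<longleftrightarrow>
     (\<exists>V. V \<noteq> {} \<and> bounded V \<and> open V \<and> (\<Union>i\<in>I. f i ` V) \<subseteq> V \<and>
          disjoint_family_on (\<lambda>i. f i ` V) I)"


section \<open>Fractal structures\<close>

text \<open>Since levels are counted with multiplicity, the level \<open>\<Gamma> n = (J, A)\<close> is the indexed family
  \<open>(A j)\<^sub>j\<close> with \<open>j \<in> J\<close>. Levels are numbered from \<open>0\<close>.\<close>

type_synonym ('i, 'a) levels = "nat \<Rightarrow> 'i set \<times> ('i \<Rightarrow> 'a set)"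

definition level_sets :: "('i, 'a) levels \<Rightarrow> nat \<Rightarrow> 'a set set" where
  "level_sets \<Gamma> n = snd (\<Gamma> n) ` fst (\<Gamma> n)"

definition fractal_structure :: "'a set \<Rightarrow> ('i, 'a) levels \<Rightarrow> bool" where
  "fractal_structure X \<Gamma> \<longleftrightarrow>
     (\<forall>n. \<Union>(level_sets \<Gamma> n) = X) \<and>
     (\<forall>n. \<forall>A\<in>level_sets \<Gamma> (Suc n). \<exists>B\<in>level_sets \<Gamma> n. A \<subseteq> B) \<and>
     (\<forall>n. \<forall>B\<in>level_sets \<Gamma> n. B = \<Union>{A \<in> level_sets \<Gamma> (Suc n). A \<subseteq> B})"

definition hitting :: "('i, 'a) levels \<Rightarrow> nat \<Rightarrow> 'a set \<Rightarrow> 'i set" where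
  "hitting \<Gamma> n F = {j \<in> fst (\<Gamma> n). snd (\<Gamma> n) j \<inter> F \<noteq> {}}"

definition level_diam :: "('i, 'a::metric_space) levels \<Rightarrow> nat \<Rightarrow> 'a set \<Rightarrow> ennreal" where
  "level_diam \<Gamma> n F = (SUP j\<in>hitting \<Gamma> n F. ediam (snd (\<Gamma> n) j))"

definition word_map :: "('i \<Rightarrow> 'a \<Rightarrow> 'a) \<Rightarrow> 'i list \<Rightarrow> 'a \<Rightarrow> 'a" where
  "word_map f w = foldr (\<lambda>i g. f i \<circ> g) w id"

definition natural_structure :: "'i set \<Rightarrow> ('i \<Rightarrow> 'a \<Rightarrow> 'a) \<Rightarrow> 'a set \<Rightarrow> ('i list, 'a) levels" where
  "natural_structure I f K n = ({w. set w \<subseteq> I \<and> length w = n}, \<lambda>w. word_map f w ` K)"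


section \<open>Dimensions defined by limits\<close>

text \<open>Each predicate says that the limit exists in the extended reals and equals \<open>d\<close>.\<close>

definition packing_number :: "real \<Rightarrow> 'a::metric_space set \<Rightarrow> ennreal" where
  "packing_number \<delta> F =
     (SUP C\<in>{C. finite C \<and> C \<subseteq> F \<and> disjoint_family_on (\<lambda>x. cball x \<delta>) C}. ecount C)"

definition has_box_dim :: "'a::metric_space set \<Rightarrow> ereal \<Rightarrow> bool" where
  "has_box_dim F d \<longleftrightarrow>
     ((\<lambda>\<delta>. eln (packing_number \<delta> F) / ereal (- ln \<delta>)) \<longlongrightarrow> d) (at_right 0)"

definition has_fractal_dim1 :: "('i, 'a) levels \<Rightarrow> 'a set \<Rightarrow> ereal \<Rightarrow> bool" where
  "has_fractal_dim1 \<Gamma> F d \<longleftrightarrow>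
     (\<lambda>n. eln (ecount (hitting \<Gamma> n F)) / ereal (real n * ln 2)) \<longlonglongrightarrow> d"

text \<open>If \<open>level_diam \<Gamma> n F = 0\<close>, the denominator is \<open>\<infinity>\<close> and the quotient is \<open>0\<close> (for finite levels).\<close>

definition has_fractal_dim2 :: "('i, 'a::metric_space) levels \<Rightarrow> 'a set \<Rightarrow> ereal \<Rightarrow> bool" where
  "has_fractal_dim2 \<Gamma> F d \<longleftrightarrow>
     (\<lambda>n. eln (ecount (hitting \<Gamma> n F)) / (- eln (level_diam \<Gamma> n F))) \<longlonglongrightarrow> d"


section \<open>Dimensions defined by measures\<close>

text \<open>A countable (finite or infinite) family is encoded as \<open>(J, U)\<close> with an index set \<open>J\<close> of natural
  numbers; only the values \<open>U j\<close> with \<open>j \<in> J\<close> matter.\<close>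

type_synonym 'a family = "nat set \<times> (nat \<Rightarrow> 'a set)"

definition covers_by :: "'a set set \<Rightarrow> 'a set \<Rightarrow> 'a family set" where
  "covers_by \<C> F = {(J, U). (\<forall>j\<in>J. U j \<in> \<C>) \<and> F \<subseteq> (\<Union>j\<in>J. U j)}"

definition cover_sum :: "real \<Rightarrow> 'a::metric_space family \<Rightarrow> ennreal" where
  "cover_sum s = (\<lambda>(J, U). \<Sum>\<^sub>\<infinity>j\<in>J. epower (ediam (U j)) s)"

definition hausdorff_pre :: "real \<Rightarrow> real \<Rightarrow> 'a::metric_space set \<Rightarrow> ennreal" where
  "hausdorff_pre \<delta> s F = (INF \<U>\<in>covers_by {U. ediam U \<le> ennreal \<delta>} F. cover_sum s \<U>)"

definition hausdorff_meas :: "real \<Rightarrow> 'a::metric_space set \<Rightarrow> ennreal" where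
  "hausdorff_meas s F = Lim (at_right 0) (\<lambda>\<delta>. hausdorff_pre \<delta> s F)"

definition frac_pre3 :: "('i, 'a::metric_space) levels \<Rightarrow> nat \<Rightarrow> real \<Rightarrow> 'a set \<Rightarrow> ennreal" where
  "frac_pre3 \<Gamma> n s F =
     (INF l\<in>{n..}. \<Sum>\<^sub>\<infinity>j\<in>hitting \<Gamma> l F. epower (ediam (snd (\<Gamma> l) j)) s)"

definition frac_pre4 :: "('i, 'a::metric_space) levels \<Rightarrow> nat \<Rightarrow> real \<Rightarrow> 'a set \<Rightarrow> ennreal" where
  "frac_pre4 \<Gamma> n s F =
     (INF \<U>\<in>{\<U> \<in> covers_by (\<Union>l\<in>{n..}. level_sets \<Gamma> l) F. finite (fst \<U>)}. cover_sum s \<U>)"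

definition frac_pre5 :: "('i, 'a::metric_space) levels \<Rightarrow> nat \<Rightarrow> real \<Rightarrow> 'a set \<Rightarrow> ennreal" where
  "frac_pre5 \<Gamma> n s F = (INF \<U>\<in>covers_by (\<Union>l\<in>{n..}. level_sets \<Gamma> l) F. cover_sum s \<U>)"

definition frac_pre6 :: "('i, 'a::metric_space) levels \<Rightarrow> real \<Rightarrow> real \<Rightarrow> 'a set \<Rightarrow> ennreal" where
  "frac_pre6 \<Gamma> \<delta> s F =
     (INF \<U>\<in>covers_by {A \<in> (\<Union>l. level_sets \<Gamma> l). ediam A \<le> ennreal \<delta>} F. cover_sum s \<U>)"

definition frac_meas3 :: "('i, 'a::metric_space) levels \<Rightarrow> real \<Rightarrow> 'a set \<Rightarrow> ennreal" where
  "frac_meas3 \<Gamma> s F = lim (\<lambda>n. frac_pre3 \<Gamma> n s F)"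

definition frac_meas4 :: "('i, 'a::metric_space) levels \<Rightarrow> real \<Rightarrow> 'a set \<Rightarrow> ennreal" where
  "frac_meas4 \<Gamma> s F = lim (\<lambda>n. frac_pre4 \<Gamma> n s F)"

definition frac_meas5 :: "('i, 'a::metric_space) levels \<Rightarrow> real \<Rightarrow> 'a set \<Rightarrow> ennreal" where
  "frac_meas5 \<Gamma> s F = lim (\<lambda>n. frac_pre5 \<Gamma> n s F)"

definition frac_meas6 :: "('i, 'a::metric_space) levels \<Rightarrow> real \<Rightarrow> 'a set \<Rightarrow> ennreal" where
  "frac_meas6 \<Gamma> s F = Lim (at_right 0) (\<lambda>\<delta>. frac_pre6 \<Gamma> \<delta> s F)"

text \<open>Exponents range over \<open>s \<ge> 0\<close>, so the supremum of the empty set of exponents is \<open>0\<close>; this is the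
  role of \<^const>\<open>insert\<close>.\<close>

definition critical_exponent :: "(real \<Rightarrow> ennreal) \<Rightarrow> ereal \<Rightarrow> bool" where
  "critical_exponent H d \<longleftrightarrow>
     d = Inf (ereal ` {s. s \<ge> 0 \<and> H s = 0}) \<and>
     d = Sup (insert 0 (ereal ` {s. s \<ge> 0 \<and> H s = \<infinity>}))"

definition has_hausdorff_dim :: "'a::metric_space set \<Rightarrow> ereal \<Rightarrow> bool" where
  "has_hausdorff_dim F d \<longleftrightarrow> critical_exponent (\<lambda>s. hausdorff_meas s F) d"

definition has_fractal_dim3 :: "('i, 'a::metric_space) levels \<Rightarrow> 'a set \<Rightarrow> ereal \<Rightarrow> bool" where
  "has_fractal_dim3 \<Gamma> F d \<longleftrightarrow> critical_exponent (\<lambda>s. frac_meas3 \<Gamma> s F) d"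

definition has_fractal_dim4 :: "('i, 'a::metric_space) levels \<Rightarrow> 'a set \<Rightarrow> ereal \<Rightarrow> bool" where
  "has_fractal_dim4 \<Gamma> F d \<longleftrightarrow> critical_exponent (\<lambda>s. frac_meas4 \<Gamma> s F) d"

definition has_fractal_dim5 :: "('i, 'a::metric_space) levels \<Rightarrow> 'a set \<Rightarrow> ereal \<Rightarrow> bool" where
  "has_fractal_dim5 \<Gamma> F d \<longleftrightarrow> critical_exponent (\<lambda>s. frac_meas5 \<Gamma> s F) d"

definition has_fractal_dim6 :: "('i, 'a::metric_space) levels \<Rightarrow> 'a set \<Rightarrow> ereal \<Rightarrow> bool" where
  "has_fractal_dim6 \<Gamma> F d \<longleftrightarrow> critical_exponent (\<lambda>s. frac_meas6 \<Gamma> s F) d"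


section \<open>The limits exist\<close>

lemma lim_mono_SUP:
  fixes g :: "nat \<Rightarrow> ennreal"
  assumes "\<And>m n. m \<le> n \<Longrightarrow> g m \<le> g n"
  shows "lim g = (SUP n. g n)"
  using assms by (intro limI LIMSEQ_SUP) (auto simp: mono_def)

lemma Lim_at_right_antimono_SUP:
  fixes g :: "real \<Rightarrow> ennreal"
  assumes "\<And>d e. d \<le> e \<Longrightarrow> g e \<le> g d"
  shows "(g \<longlongrightarrow> (SUP d\<in>{0<..}. g d)) (at_right 0)"
    and "Lim (at_right 0) g = (SUP d\<in>{0<..}. g d)"
proof -
  show lim: "(g \<longlongrightarrow> (SUP d\<in>{0<..}. g d)) (at_right 0)"
  proof (rule order_tendstoI)
    fix a assume "a < (SUP d\<in>{0<..}. g d)"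
    then obtain d where d: "d > 0" "a < g d"
      by (auto simp: less_SUP_iff)
    have "a < g e" if "e < d" for e
      using d assms[of e d] that by (meson less_imp_le order.strict_trans2)
    then show "\<forall>\<^sub>F x in at_right 0. a < g x"
      using d by (auto simp: eventually_at_right_field)
  next
    fix a assume a: "(SUP d\<in>{0<..}. g d) < a"
    have "g e < a" if "e > 0" for e
      using a that by (meson SUP_upper greaterThan_iff order.strict_trans1)
    then show "\<forall>\<^sub>F x in at_right 0. g x < a"
      by (auto simp: eventually_at_right_field intro!: exI[of _ 1])
  qed
  then show "Lim (at_right 0) g = (SUP d\<in>{0<..}. g d)"
    by (intro tendsto_Lim) auto
qed

lemma covers_by_mono: "\<C> \<subseteq> \<D> \<Longrightarrow> covers_by \<C> F \<subseteq> covers_by \<D> F"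
  by (auto simp: covers_by_def)

lemma hausdorff_meas_eq_SUP: "hausdorff_meas s F = (SUP \<delta>\<in>{0<..}. hausdorff_pre \<delta> s F)"
  unfolding hausdorff_meas_def hausdorff_pre_def
  by (intro Lim_at_right_antimono_SUP(2) INF_superset_mono covers_by_mono)
     (auto intro: order_trans ennreal_leI)

lemma frac_meas3_eq_SUP: "frac_meas3 \<Gamma> s F = (SUP n. frac_pre3 \<Gamma> n s F)"
  unfolding frac_meas3_def frac_pre3_def
  by (intro lim_mono_SUP INF_superset_mono) auto

lemma frac_meas4_eq_SUP: "frac_meas4 \<Gamma> s F = (SUP n. frac_pre4 \<Gamma> n s F)"
proof -
  have "covers_by (\<Union>l\<in>{n..}. level_sets \<Gamma> l) F \<subseteq> covers_by (\<Union>l\<in>{m..}. level_sets \<Gamma> l) F"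
    if "m \<le> n" for m n
    using that by (intro covers_by_mono UN_mono) auto
  then show ?thesis
    unfolding frac_meas4_def frac_pre4_def
    by (intro lim_mono_SUP INF_superset_mono) auto
qed

lemma frac_meas5_eq_SUP: "frac_meas5 \<Gamma> s F = (SUP n. frac_pre5 \<Gamma> n s F)"
  unfolding frac_meas5_def frac_pre5_def
  by (intro lim_mono_SUP INF_superset_mono covers_by_mono UN_mono) auto

lemma frac_meas6_eq_SUP: "frac_meas6 \<Gamma> s F = (SUP \<delta>\<in>{0<..}. frac_pre6 \<Gamma> \<delta> s F)"
  unfolding frac_meas6_def frac_pre6_def
  by (intro Lim_at_right_antimono_SUP(2) INF_superset_mono covers_by_mono)
     (auto intro: order_trans ennreal_leI)


section \<open>The natural structure is a fractal structure with vanishing diameters\<close>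

lemma word_map_simps [simp]:
  "word_map f [] = id"
  "word_map f (i # w) = f i \<circ> word_map f w"
  by (simp_all add: word_map_def)

lemma word_map_append: "word_map f (v @ w) = word_map f v \<circ> word_map f w"
  by (induction v) auto

lemma level_sets_natural_structure:
  "level_sets (natural_structure I f K) n = {word_map f w ` K |w. set w \<subseteq> I \<and> length w = n}"
  by (auto simp: level_sets_def natural_structure_def)

lemma fractal_structure_natural_structure:
  assumes "is_attractor I f K"
  shows "fractal_structure K (natural_structure I f K)"
proof -
  let ?L = "level_sets (natural_structure I f K)"
  have K: "K = (\<Union>i\<in>I. f i ` K)"
    using assms unfolding is_attractor_def by blast
  have sub: "f i ` K \<subseteq> K" if "i \<in> I" for i
    using K that by blast
  have split: "word_map f w ` K = (\<Union>i\<in>I. word_map f (w @ [i]) ` K)" for w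
  proof -
    have "word_map f w ` K = word_map f w ` (\<Union>i\<in>I. f i ` K)"
      by (rule arg_cong[OF K])
    then show ?thesis
      unfolding word_map_append by (simp add: image_UN image_comp)
  qed
  have step: "word_map f (w @ [i]) ` K \<subseteq> word_map f w ` K" if "i \<in> I" for w i
    using split that by blast
  have "\<Union>(?L n) = K" for n
  proof (induction n)
    case 0
    then show ?case by (auto simp: level_sets_natural_structure)
  next
    case (Suc n)
    have "?L (Suc n) = (\<Union>i\<in>I. (`) (f i) ` ?L n)"
    proof (intro set_eqI iffI)
      fix A assume "A \<in> ?L (Suc n)"
      then obtain i w where "A = word_map f (i # w) ` K" "i \<in> I" "set w \<subseteq> I" "length w = n"
        by (auto simp: level_sets_natural_structure length_Suc_conv)
      then have "A = f i ` word_map f w ` K" "word_map f w ` K \<in> ?L n"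
        by (auto simp: level_sets_natural_structure)
      then show "A \<in> (\<Union>i\<in>I. (`) (f i) ` ?L n)"
        using \<open>i \<in> I\<close> by blast
    next
      fix A assume "A \<in> (\<Union>i\<in>I. (`) (f i) ` ?L n)"
      then obtain i w where "A = f i ` word_map f w ` K" "i \<in> I" "set w \<subseteq> I" "length w = n"
        by (auto simp: level_sets_natural_structure)
      then show "A \<in> ?L (Suc n)"
        unfolding level_sets_natural_structure
        by (intro CollectI exI[of _ "i # w"]) (auto simp: image_comp)
    qed
    then have "\<Union>(?L (Suc n)) = (\<Union>i\<in>I. f i ` \<Union>(?L n))"
      by (simp only: image_Union) auto
    also have "\<dots> = K"
      unfolding Suc.IH using K by (rule sym)
    finally show ?case .
  qed
  moreover have "\<exists>B\<in>?L n. A \<subseteq> B" if A: "A \<in> ?L (Suc n)" for A n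
  proof -
    obtain w where w: "A = word_map f w ` K" "set w \<subseteq> I" "length w = Suc n"
      using A by (auto simp: level_sets_natural_structure)
    then obtain v i where v: "w = v @ [i]"
      by (metis length_Suc_conv_rev)
    have "A \<subseteq> word_map f v ` K" "word_map f v ` K \<in> ?L n"
      using w v step[of i v] by (auto simp: level_sets_natural_structure)
    then show ?thesis by blast
  qed
  moreover have "B = \<Union>{A \<in> ?L (Suc n). A \<subseteq> B}" if B: "B \<in> ?L n" for B n
  proof -
    obtain w where w: "B = word_map f w ` K" "set w \<subseteq> I" "length w = n"
      using B by (auto simp: level_sets_natural_structure)
    have "word_map f (w @ [i]) ` K \<in> {A \<in> ?L (Suc n). A \<subseteq> B}" if "i \<in> I" for i
      using w that step[of i w]
      unfolding level_sets_natural_structure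
      by (intro CollectI conjI exI[of _ "w @ [i]"]) auto
    then show ?thesis using split[of w] w(1) by blast
  qed
  ultimately show ?thesis
    unfolding fractal_structure_def by blast
qed

lemma level_diam_natural_structure_tendsto_0:
  fixes K :: "'a::metric_space set"
  assumes "finite I" and sim: "\<And>i. i \<in> I \<Longrightarrow> similarity (c i) (f i) \<and> c i < 1"
    and K: "is_attractor I f K"
  shows "level_diam (natural_structure I f K) n K \<le> ennreal (Max (c ` I) ^ n * diameter K)"
    and "(\<lambda>n. level_diam (natural_structure I f K) n K) \<longlonglongrightarrow> 0"
proof -
  define q where "q = Max (c ` I)"
  have "I \<noteq> {}" using K unfolding is_attractor_def by blast
  then have "q \<in> c ` I" and cq: "\<And>i. i \<in> I \<Longrightarrow> c i \<le> q"
    using \<open>finite I\<close> by (auto simp: q_def)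
  then have q: "0 < q" "q < 1" using sim by (auto simp: similarity_def)
  have bK: "bounded K" and neK: "K \<noteq> {}"
    using K unfolding is_attractor_def by (blast intro: compact_imp_bounded)+
  have dist: "dist (word_map f w x) (word_map f w y) \<le> q ^ length w * dist x y"
    if "set w \<subseteq> I" for w x y
    using that
  proof (induction w)
    case (Cons i w)
    have "dist (word_map f (i # w) x) (word_map f (i # w) y)
        = c i * dist (word_map f w x) (word_map f w y)"
      using sim[of i] Cons.prems by (auto simp: similarity_def)
    also have "\<dots> \<le> q * (q ^ length w * dist x y)"
      using Cons cq[of i] q by (intro mult_mono) auto
    finally show ?case by simp
  qed auto
  have dist': "dist (word_map f w x) (word_map f w y) \<le> q ^ length w * diameter K"
    if "set w \<subseteq> I" "x \<in> K" "y \<in> K" for w x y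
    using dist[OF that(1), of x y] diameter_bounded_bound[OF bK that(2,3)] q
    by (meson mult_left_mono order_trans zero_le_power less_imp_le)
  have "ediam (word_map f w ` K) \<le> ennreal (q ^ length w * diameter K)" if "set w \<subseteq> I" for w
  proof -
    have "bounded (word_map f w ` K)"
      using dist'[OF that] by (auto simp: bounded_two_points)
    moreover have "diameter (word_map f w ` K) \<le> q ^ length w * diameter K"
      using dist'[OF that] neK unfolding diameter_def
      by (auto intro!: cSUP_least)
    ultimately show ?thesis by (auto simp: ediam_def intro: ennreal_leI)
  qed
  then have le: "level_diam (natural_structure I f K) n K \<le> ennreal (q ^ n * diameter K)" for n
    by (auto simp: level_diam_def hitting_def natural_structure_def intro!: SUP_least)
  then show "level_diam (natural_structure I f K) n K \<le> ennreal (Max (c ` I) ^ n * diameter K)"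
    by (simp add: q_def)
  have "(\<lambda>n. q ^ n * diameter K) \<longlonglongrightarrow> 0"
    using q by (intro tendsto_mult_left_zero LIMSEQ_realpow_zero) auto
  then have "(\<lambda>n. ennreal (q ^ n * diameter K)) \<longlonglongrightarrow> 0"
    using tendsto_ennrealI by fastforce
  then show "(\<lambda>n. level_diam (natural_structure I f K) n K) \<longlonglongrightarrow> 0"
    by (rule tendsto_sandwich[OF _ _ tendsto_const, rotated 2]) (use le in auto)
qed

end

theory Submission
  imports Defs
begin

text \<open>
  Every covering admitted by one of the measures of types III, IV, V, VI
  is, up to a shift of the level or of the bound on the diameters, admitted by the next one in this
  list, and finally by the Hausdorff measure. So the Hausdorff measure is the smallest of the five
  and the measure of type III is the largest, for every exponent. It suffices to estimate the two ends
  of the chain (\<open>intermediate_measure\<close>).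

  The upper end is an exact computation. The image of \<open>K\<close> under a word map is \<open>K\<close> scaled by the
  product of the contraction ratios of its letters, so that the sum of the \<open>t\<close>-th powers of the diameters over level
  \<open>l\<close> is \<open>(\<Sum>i\<in>I. c i powr t) ^ l\<close> times \<open>diam\<^sup>t\<close> of \<open>K\<close> (\<open>frac_pre3_eq\<close>). The base is \<open>1\<close> at \<open>t = s\<close> and less
  than \<open>1\<close> beyond \<open>s\<close>.

  The lower end, \<open>hausdorff_meas_pos\<close>, is the mass distribution principle. Give a word the weight
  \<open>(ratio c w) powr s\<close>; the words of each length have total weight \<open>1\<close>. A set \<open>U\<close> of diameter at most \<open>d\<close>
  receives weight at most a constant times \<open>d\<^sup>s\<close> (\<open>mass_bound\<close>): cut every word as soon as its ratio drops to
  \<open>d\<close>; the images of the open set under the maps of the cut words are disjoint and contain balls of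
  radius comparable to \<open>d\<close>, hence only boundedly many of them come near \<open>U\<close>. No measure on \<open>K\<close> has to
  be constructed. The weight of \<open>U\<close> is taken to be the weight of the words of one large length \<open>n\<close> that
  send a chosen point of \<open>K\<close> into \<open>U\<close>, and by compactness of \<open>K\<close> only finitely many sets \<open>U\<close> have to be
  treated at a time, so that a common \<open>n\<close> exists (\<open>finite_cover_bound\<close>).

  The same two facts give the box dimension (\<open>packing_number_bounds\<close>). The cut words have total weight
  \<open>1\<close> and individual weights comparable to \<open>\<delta>\<^sup>s\<close>, which bounds packings from above. The balls of doubled
  radius about a maximal packing cover \<open>K\<close>, which bounds packings from below.

  If all contraction ratios equal \<open>r\<close>, level \<open>n\<close> consists of \<open>card I ^ n\<close> sets of diameter \<open>r ^ n\<close> times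
  that of \<open>K\<close>, and \<open>card I * r powr s = 1\<close>. This yields the dimensions I and II, and equality in the final
  inequality.
\<close>

section \<open>Powers of diameters\<close>

lemma epower_ennreal:
  assumes "x \<ge> 0"
  shows "epower (ennreal x) s = ennreal (if s = 0 then 1 else x powr s)"
  using assms by (simp add: epower_def)

lemma epower_mult_ennreal:
  assumes "0 < a" "0 \<le> x"
  shows "epower (ennreal (a * x)) s = ennreal (a powr s) * epower (ennreal x) s"
proof -
  have "epower (ennreal (a * x)) s = ennreal (if s = 0 then 1 else (a * x) powr s)"
    using assms by (intro epower_ennreal) auto
  then show ?thesis
    using assms by (auto simp: epower_ennreal powr_mult ennreal_mult)
qed

text \<open>A set of diameter at most \<open>\<delta>\<close> has \<open>diam\<^sup>t \<ge> \<delta>\<^sup>t\<^sup>-\<^sup>s diam\<^sup>s\<close> for \<open>t < s\<close>: this is why a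
  Hausdorff-type measure that does not vanish at \<open>s\<close> is infinite below \<open>s\<close>.\<close>

lemma epower_ge_smaller_exponent:
  assumes "x \<le> ennreal \<delta>" "0 < \<delta>" "0 \<le> t" "t < s"
  shows "ennreal (\<delta> powr (t - s)) * epower x s \<le> epower x t"
proof -
  obtain y where y: "x = ennreal y" "0 \<le> y"
    using assms(1) by (cases x) (auto simp: top_unique)
  then have "y \<le> \<delta>"
    using assms by (simp add: ennreal_le_iff)
  show ?thesis
  proof (cases "y = 0")
    case False
    have "\<delta> powr (t - s) * y powr s \<le> y powr (t - s) * y powr s"
      using assms y False \<open>y \<le> \<delta>\<close> by (intro mult_right_mono powr_mono2') auto
    also have "\<dots> = y powr t"
      using False y by (simp flip: powr_add)
    finally have "ennreal (\<delta> powr (t - s) * y powr s) \<le> ennreal (y powr t)"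
      by (rule ennreal_leI)
    then show ?thesis
      using assms y False by (cases "t = 0") (simp_all add: epower_ennreal ennreal_mult)
  qed (use assms y in \<open>simp add: epower_def\<close>)
qed

lemma eln_of_nat: "0 < m \<Longrightarrow> eln (of_nat m) = ereal (ln (real m))"
  by (simp add: eln_def)

section \<open>Critical exponents and comparison of the measures\<close>

lemma critical_exponentI:
  assumes "0 \<le> s"
    and zero: "\<And>t. s < t \<Longrightarrow> H t = 0"
    and infinite: "\<And>t. 0 \<le> t \<Longrightarrow> t < s \<Longrightarrow> H t = \<infinity>"
  shows "critical_exponent H (ereal s)"
proof -
  have "Inf (ereal ` {t. t \<ge> 0 \<and> H t = 0}) = ereal s"
  proof (rule antisym)
    show "Inf (ereal ` {t. t \<ge> 0 \<and> H t = 0}) \<le> ereal s"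
    proof (rule ereal_le_epsilon2)
      fix e :: real assume "0 < e"
      then have "s + e \<in> {t. t \<ge> 0 \<and> H t = 0}"
        using assms(1) zero[of "s + e"] by auto
      then show "Inf (ereal ` {t. t \<ge> 0 \<and> H t = 0}) \<le> ereal s + ereal e"
        by (auto intro!: Inf_lower)
    qed
    show "ereal s \<le> Inf (ereal ` {t. t \<ge> 0 \<and> H t = 0})"
    proof (rule Inf_greatest)
      fix u assume "u \<in> ereal ` {t. t \<ge> 0 \<and> H t = 0}"
      then show "ereal s \<le> u"
        using infinite by (force simp: not_le[symmetric])
    qed
  qed
  moreover have "Sup (insert 0 (ereal ` {t. t \<ge> 0 \<and> H t = \<infinity>})) = ereal s"
  proof (rule antisym)
    show "Sup (insert 0 (ereal ` {t. t \<ge> 0 \<and> H t = \<infinity>})) \<le> ereal s"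
    proof (rule Sup_least)
      fix u assume "u \<in> insert 0 (ereal ` {t. t \<ge> 0 \<and> H t = \<infinity>})"
      then show "u \<le> ereal s"
        using assms(1) zero by (force simp: not_le[symmetric])
    qed
    show "ereal s \<le> Sup (insert 0 (ereal ` {t. t \<ge> 0 \<and> H t = \<infinity>}))"
    proof (rule ccontr)
      let ?S = "Sup (insert 0 (ereal ` {t. t \<ge> 0 \<and> H t = \<infinity>}))"
      assume "\<not> ereal s \<le> ?S"
      then obtain t where t: "?S < ereal t" "t < s"
        using ereal_dense2[of ?S "ereal s"] by (auto simp: not_le)
      have "0 \<le> ?S" by (rule Sup_upper) auto
      then have "0 \<le> t"
        using t(1) by (metis ereal_less_eq(5) less_imp_le order_trans)
      then have "ereal t \<le> ?S"
        using infinite t(2) by (intro Sup_upper) auto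
      with t(1) show False by (meson leD)
    qed
  qed
  ultimately show ?thesis
    by (simp add: critical_exponent_def)
qed

text \<open>Coverings by sets of diameter at most \<open>\<delta>\<close> cost at least \<open>\<delta>\<^sup>t\<^sup>-\<^sup>s\<close> times as much at exponent \<open>t\<close> as at
  exponent \<open>s\<close>, and this factor tends to infinity with \<open>\<delta> \<rightarrow> 0\<close>.\<close>

lemma hausdorff_meas_infinite_below:
  assumes "0 < hausdorff_meas s F" "0 \<le> t" "t < s"
  shows "hausdorff_meas t F = \<infinity>"
proof -
  obtain \<delta>0 where \<delta>0: "0 < \<delta>0" "0 < hausdorff_pre \<delta>0 s F"
    using assms(1) by (auto simp: hausdorff_meas_eq_SUP less_SUP_iff)
  have anti: "hausdorff_pre \<delta>0 s F \<le> hausdorff_pre \<delta> s F" if "\<delta> \<le> \<delta>0" for \<delta>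
    unfolding hausdorff_pre_def using that
    by (intro INF_superset_mono covers_by_mono) (auto intro: order_trans ennreal_leI)
  have step: "ennreal (\<delta> powr (t - s)) * hausdorff_pre \<delta>0 s F \<le> hausdorff_meas t F"
    if \<delta>: "0 < \<delta>" "\<delta> \<le> \<delta>0" for \<delta>
  proof -
    have "ennreal (\<delta> powr (t - s)) * hausdorff_pre \<delta>0 s F \<le> cover_sum t \<U>"
      if \<U>: "\<U> \<in> covers_by {U. ediam U \<le> ennreal \<delta>} F" for \<U>
    proof -
      obtain J U where JU: "\<U> = (J, U)" by (cases \<U>)
      have "ennreal (\<delta> powr (t - s)) * hausdorff_pre \<delta>0 s F
          \<le> ennreal (\<delta> powr (t - s)) * cover_sum s \<U>"
        using anti[OF \<delta>(2)] \<U> unfolding hausdorff_pre_def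
        by (intro mult_left_mono) (auto intro: order_trans INF_lower)
      also have "\<dots> = (\<Sum>\<^sub>\<infinity>j\<in>J. ennreal (\<delta> powr (t - s)) * epower (ediam (U j)) s)"
        by (simp add: JU cover_sum_def SUP_mult_left_ennreal nonneg_infsum_complete sum_distrib_left
          infsum_nonneg_is_SUPREMUM_ennreal)
      also have "\<dots> \<le> (\<Sum>\<^sub>\<infinity>j\<in>J. epower (ediam (U j)) t)"
        using \<U> assms \<delta> unfolding JU covers_by_def
        by (intro infsum_mono epower_ge_smaller_exponent nonneg_summable_on_complete) auto
      finally show ?thesis by (simp add: JU cover_sum_def)
    qed
    then have "ennreal (\<delta> powr (t - s)) * hausdorff_pre \<delta>0 s F \<le> hausdorff_pre \<delta> t F"
      unfolding hausdorff_pre_def[of \<delta> t] by (rule INF_greatest)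
    also have "\<dots> \<le> hausdorff_meas t F"
      unfolding hausdorff_meas_eq_SUP using \<delta> by (intro SUP_upper) auto
    finally show ?thesis .
  qed
  have lim: "((\<lambda>\<delta>. ennreal (\<delta> powr (t - s)) * hausdorff_pre \<delta>0 s F) \<longlongrightarrow> \<infinity>) (at_right 0)"
  proof -
    have "filterlim (\<lambda>\<delta>::real. \<delta> powr (t - s)) at_top (at_right 0)"
    proof -
      have "((\<lambda>\<delta>::real. \<delta> powr (s - t)) \<longlongrightarrow> 0) (at_right 0)"
        using assms(3) by (intro tendsto_zero_powrI[where b = "s - t"] tendsto_ident_at tendsto_const)
          (auto simp: eventually_at_right_field intro!: exI[of _ 1])
      then have "filterlim (\<lambda>\<delta>::real. inverse (\<delta> powr (s - t))) at_top (at_right 0)"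
        by (rule filterlim_inverse_at_top) (auto simp: eventually_at_right_field intro!: exI[of _ 1])
      then show ?thesis
        by (simp flip: powr_minus)
    qed
    then have "((\<lambda>\<delta>. ennreal (\<delta> powr (t - s))) \<longlongrightarrow> \<infinity>) (at_right 0)"
      by (simp add: ennreal_tendsto_top_eq_at_top)
    then have "((\<lambda>\<delta>. ennreal (\<delta> powr (t - s)) * hausdorff_pre \<delta>0 s F)
        \<longlongrightarrow> \<infinity> * hausdorff_pre \<delta>0 s F) (at_right 0)"
      using \<delta>0 by (intro tendsto_mult_ennreal tendsto_const) auto
    then show ?thesis
      using \<delta>0(2) by (simp add: ennreal_top_mult split: if_split_asm)
  qed
  have "\<infinity> \<le> hausdorff_meas t F"
    by (rule tendsto_upperbound[OF lim])
       (use step \<delta>0 in \<open>auto simp: eventually_at_right_field intro!: exI[of _ \<delta>0]\<close>)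
  then show ?thesis by (simp add: top_unique)
qed

lemma hausdorff_meas_le_frac_meas6: "hausdorff_meas s F \<le> frac_meas6 \<Gamma> s F"
  unfolding hausdorff_meas_eq_SUP frac_meas6_eq_SUP hausdorff_pre_def frac_pre6_def
  by (intro SUP_mono') (auto intro!: INF_superset_mono covers_by_mono)

text \<open>Far enough down, every set of a level has diameter at most \<open>\<delta>\<close>. The level diameters are measured on a
  set \<open>X\<close> that contains all sets of the structure, so that every one of them is seen.\<close>

lemma frac_meas6_le_frac_meas5:
  assumes "(\<lambda>n. level_diam \<Gamma> n X) \<longlonglongrightarrow> 0"
    and sub: "\<And>n A. A \<in> level_sets \<Gamma> n \<Longrightarrow> A \<noteq> {} \<and> A \<subseteq> X"
  shows "frac_meas6 \<Gamma> s F \<le> frac_meas5 \<Gamma> s F"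
  unfolding frac_meas6_eq_SUP
proof (rule SUP_least)
  fix \<delta> :: real assume "\<delta> \<in> {0<..}"
  then have "\<forall>\<^sub>F n in sequentially. level_diam \<Gamma> n X < ennreal \<delta>"
    using order_tendstoD(2)[OF assms(1)] by simp
  then obtain n where n: "\<And>m. n \<le> m \<Longrightarrow> level_diam \<Gamma> m X < ennreal \<delta>"
    by (auto simp: eventually_sequentially)
  have "ediam A \<le> ennreal \<delta>" if "n \<le> m" "A \<in> level_sets \<Gamma> m" for m A
  proof -
    have "ediam A \<le> level_diam \<Gamma> m X"
      using that(2) sub[OF that(2)] unfolding level_diam_def level_sets_def hitting_def
      by (auto intro!: SUP_upper2)
    with n[OF that(1)] show ?thesis by auto
  qed
  then have "frac_pre6 \<Gamma> \<delta> s F \<le> frac_pre5 \<Gamma> n s F"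
    unfolding frac_pre6_def frac_pre5_def by (intro INF_superset_mono covers_by_mono) auto
  also have "\<dots> \<le> frac_meas5 \<Gamma> s F"
    unfolding frac_meas5_eq_SUP by (intro SUP_upper) auto
  finally show "frac_pre6 \<Gamma> \<delta> s F \<le> frac_meas5 \<Gamma> s F" .
qed

lemma frac_meas5_le_frac_meas4: "frac_meas5 \<Gamma> s F \<le> frac_meas4 \<Gamma> s F"
  unfolding frac_meas5_eq_SUP frac_meas4_eq_SUP frac_pre5_def frac_pre4_def
  by (intro SUP_mono') (auto intro!: INF_superset_mono)

text \<open>A whole level is a finite covering; only its indices have to be replaced by natural numbers.\<close>

lemma frac_meas4_le_frac_meas3:
  assumes fin: "\<And>n. finite (fst (\<Gamma> n))" and cov: "\<And>n. F \<subseteq> \<Union>(level_sets \<Gamma> n)"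
  shows "frac_meas4 \<Gamma> s F \<le> frac_meas3 \<Gamma> s F"
  unfolding frac_meas4_eq_SUP frac_meas3_eq_SUP
proof (rule SUP_mono')
  fix n
  show "frac_pre4 \<Gamma> n s F \<le> frac_pre3 \<Gamma> n s F"
    unfolding frac_pre3_def
  proof (rule INF_greatest)
    fix l assume l: "l \<in> {n..}"
    have finh: "finite (hitting \<Gamma> l F)"
      using fin[of l] by (simp add: hitting_def)
    then obtain h where h: "bij_betw h {0..<card (hitting \<Gamma> l F)} (hitting \<Gamma> l F)"
      using ex_bij_betw_nat_finite by blast
    define J where "J = {0..<card (hitting \<Gamma> l F)}"
    define U where "U = (\<lambda>j. snd (\<Gamma> l) (h j))"
    have hJ: "h ` J = hitting \<Gamma> l F"
      using h by (simp add: J_def bij_betw_def)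
    have "F \<subseteq> (\<Union>i\<in>hitting \<Gamma> l F. snd (\<Gamma> l) i)"
      using cov[of l] by (fastforce simp: hitting_def level_sets_def)
    then have "F \<subseteq> (\<Union>j\<in>J. U j)"
      by (auto simp: U_def simp flip: hJ)
    moreover have "U j \<in> level_sets \<Gamma> l" if "j \<in> J" for j
      using hJ that by (auto simp: U_def level_sets_def hitting_def)
    ultimately have "(J, U) \<in> {\<U> \<in> covers_by (\<Union>l\<in>{n..}. level_sets \<Gamma> l) F. finite (fst \<U>)}"
      using l unfolding covers_by_def J_def by fastforce
    then have "frac_pre4 \<Gamma> n s F \<le> cover_sum s (J, U)"
      unfolding frac_pre4_def by (rule INF_lower)
    also have "\<dots> = (\<Sum>j\<in>J. epower (ediam (snd (\<Gamma> l) (h j))) s)"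
      by (simp add: cover_sum_def J_def U_def)
    also have "\<dots> = (\<Sum>i\<in>hitting \<Gamma> l F. epower (ediam (snd (\<Gamma> l) i)) s)"
      using h unfolding J_def[symmetric] by (rule sum.reindex_bij_betw)
    also have "\<dots> = (\<Sum>\<^sub>\<infinity>i\<in>hitting \<Gamma> l F. epower (ediam (snd (\<Gamma> l) i)) s)"
      using finh by simp
    finally show "frac_pre4 \<Gamma> n s F
        \<le> (\<Sum>\<^sub>\<infinity>i\<in>hitting \<Gamma> l F. epower (ediam (snd (\<Gamma> l) i)) s)" .
  qed
qed

section \<open>Similarities and separated points of Euclidean space\<close>

text \<open>Up to a translation and a rescaling, a similarity is an isometry that fixes the origin, hence an
  orthogonal transformation. Surjectivity is needed to see that images of balls are whole balls.\<close>

lemma similarity_imp_surj: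
  fixes f :: "'a::euclidean_space \<Rightarrow> 'a"
  assumes "similarity c f"
  shows "surj f"
proof -
  have c: "c > 0" and f: "\<And>x y. dist (f x) (f y) = c * dist x y"
    using assms by (auto simp: similarity_def)
  define g where "g x = (f x - f 0) /\<^sub>R c" for x
  have "dist (g x) (g y) = dist x y" for x y
  proof -
    have "dist (g x) (g y) = norm ((f x - f y) /\<^sub>R c)"
      by (simp add: g_def dist_norm flip: scaleR_diff_right)
    also have "\<dots> = dist x y"
      using c f[of x y] by (simp add: dist_norm)
    finally show ?thesis .
  qed
  then have "orthogonal_transformation g"
    by (auto simp: orthogonal_transformation_isometry g_def)
  then have "surj g"
    by (rule orthogonal_transformation_surj)
  have "y \<in> range f" for y
  proof -
    obtain x where "g x = (y - f 0) /\<^sub>R c"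
      using \<open>surj g\<close> by (metis surjD)
    then have "f x = y"
      using c by (simp add: g_def)
    then show ?thesis by blast
  qed
  then show ?thesis by blast
qed

lemma similarity_ball:
  fixes f :: "'a::euclidean_space \<Rightarrow> 'a"
  assumes "similarity c f"
  shows "f ` ball x r = ball (f x) (c * r)"
proof -
  have c: "c > 0" and f: "\<And>x y. dist (f x) (f y) = c * dist x y"
    using assms by (auto simp: similarity_def)
  have "y \<in> f ` ball x r" if y: "y \<in> ball (f x) (c * r)" for y
  proof -
    obtain z where z: "y = f z"
      using similarity_imp_surj[OF assms] by (metis surjD)
    then have "z \<in> ball x r" using y f c by auto
    then show ?thesis using z by blast
  qed
  then show ?thesis using f c by auto
qed

text \<open>Rescale to the unit ball and cover it by finitely many balls of radius \<open>\<epsilon> / 2\<close>; each of them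
  contains at most one of the separated points.\<close>

lemma separated_card_bounded:
  fixes \<epsilon> :: real
  assumes "\<epsilon> > 0"
  shows "\<exists>M>0. \<forall>(y :: 'a::euclidean_space) r S. r > 0 \<longrightarrow> S \<subseteq> cball y r \<longrightarrow>
    (\<forall>a\<in>S. \<forall>b\<in>S. a \<noteq> b \<longrightarrow> \<epsilon> * r \<le> dist a b) \<longrightarrow> finite S \<and> card S \<le> M"
proof -
  have "compact (cball (0 :: 'a) 1)" by simp
  then obtain T where T: "finite T" "cball (0 :: 'a) 1 \<subseteq> (\<Union>t\<in>T. ball t (\<epsilon> / 2))"
    using assms unfolding compact_eq_totally_bounded by (metis half_gt_zero)
  have "finite S \<and> card S \<le> Suc (card T)"
    if r: "r > 0" and S: "S \<subseteq> cball y r"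
      and sep: "\<And>a b. a \<in> S \<Longrightarrow> b \<in> S \<Longrightarrow> a \<noteq> b \<Longrightarrow> \<epsilon> * r \<le> dist a b"
    for y :: 'a and r S
  proof -
    define g where "g a = (a - y) /\<^sub>R r" for a
    have "g a \<in> cball 0 1" if "a \<in> S" for a
    proof -
      have "norm (a - y) \<le> r"
        using that S by (auto simp: dist_norm norm_minus_commute)
      then show ?thesis using r by (simp add: g_def divide_simps)
    qed
    then have "\<forall>a\<in>S. \<exists>t\<in>T. g a \<in> ball t (\<epsilon> / 2)"
      using T(2) by blast
    then obtain h where h: "\<And>a. a \<in> S \<Longrightarrow> h a \<in> T \<and> g a \<in> ball (h a) (\<epsilon> / 2)"
      by metis
    have "inj_on h S"
    proof (rule inj_onI, rule ccontr)
      fix a b assume ab: "a \<in> S" "b \<in> S" "h a = h b" "a \<noteq> b"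
      have "dist (g a) (g b) < \<epsilon>"
        using h[OF ab(1)] h[OF ab(2)] ab(3) dist_triangle_half_r[of "h a" "g a" \<epsilon> "g b"] by simp
      moreover have "dist (g a) (g b) = dist a b / r"
        using r by (simp add: g_def dist_norm divide_simps flip: scaleR_diff_right)
      ultimately show False
        using sep[OF ab(1,2,4)] r by (simp add: field_simps)
    qed
    moreover have "h ` S \<subseteq> T" using h by blast
    ultimately show ?thesis
      using card_inj_on_le[of h S T] T(1) by (auto intro: inj_on_finite)
  qed
  then show ?thesis
    by (intro exI[of _ "Suc (card T)"] conjI allI impI) auto
qed

section \<open>Words and their contraction ratios\<close>

definition words :: "'i set \<Rightarrow> nat \<Rightarrow> 'i list set" where
  "words I n = {w. set w \<subseteq> I \<and> length w = n}"

definition ratio :: "('i \<Rightarrow> real) \<Rightarrow> 'i list \<Rightarrow> real" where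
  "ratio c w = prod_list (map c w)"

lemma ratio_simps [simp]:
  "ratio c [] = 1" "ratio c (i # w) = c i * ratio c w" "ratio c (v @ w) = ratio c v * ratio c w"
  by (simp_all add: ratio_def)

text \<open>A word is cut at its first prefix whose contraction ratio is at most \<open>\<delta>\<close>. The images of a set
  under the maps of the resulting words are comparable in size, although the contraction ratios
  of the single maps differ. After the letter \<open>i\<close>, the rest of the word is cut relative to the scale
  \<open>\<delta> / c i\<close>.\<close>

fun stop :: "('i \<Rightarrow> real) \<Rightarrow> real \<Rightarrow> 'i list \<Rightarrow> 'i list" where
  "stop c \<delta> [] = []"
| "stop c \<delta> (i # w) = (if 1 \<le> \<delta> then [] else i # stop c (\<delta> / c i) w)"

lemma stop_ge_1 [simp]: "1 \<le> \<delta> \<Longrightarrow> stop c \<delta> w = []"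
  by (cases w) auto

lemma stop_append: "stop c \<delta> w @ drop (length (stop c \<delta> w)) w = w"
  by (induction c \<delta> w rule: stop.induct) auto

lemma set_stop_subset: "set (stop c \<delta> w) \<subseteq> set w"
  by (metis stop_append set_append sup_ge1)

locale ifs =
  fixes I :: "'i set" and f :: "'i \<Rightarrow> 'a::euclidean_space \<Rightarrow> 'a" and c :: "'i \<Rightarrow> real"
    and K :: "'a set"
  assumes finite_I: "finite I"
    and contractive_similarity: "\<And>i. i \<in> I \<Longrightarrow> 0 < c i \<and> c i < 1 \<and> similarity (c i) (f i)"
    and attractor: "is_attractor I f K"
begin

lemma I_nonempty: "I \<noteq> {}" and K_nonempty: "K \<noteq> {}" and K_compact: "compact K"
  using attractor unfolding is_attractor_def by blast+

lemma K_bounded: "bounded K"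
  using K_compact by (rule compact_imp_bounded)

lemma similarity_word_map: "set w \<subseteq> I \<Longrightarrow> similarity (ratio c w) (word_map f w)"
  using contractive_similarity by (induction w) (auto simp: similarity_def)

lemma dist_word_map:
  "set w \<subseteq> I \<Longrightarrow> dist (word_map f w x) (word_map f w y) = ratio c w * dist x y"
  using similarity_word_map by (auto simp: similarity_def)

lemma ratio_pos: "set w \<subseteq> I \<Longrightarrow> 0 < ratio c w"
  using similarity_word_map by (auto simp: similarity_def)

lemma word_map_image_subset:
  assumes "(\<Union>i\<in>I. f i ` X) \<subseteq> X" "set w \<subseteq> I"
  shows "word_map f w ` X \<subseteq> X"
  using assms(2)
proof (induction w)
  case (Cons i w)
  then have "word_map f (i # w) ` X \<subseteq> f i ` X"
    by (auto simp flip: image_image)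
  also have "\<dots> \<subseteq> X" using assms(1) Cons.prems by auto
  finally show ?case .
qed auto

lemma word_map_image_K: "set w \<subseteq> I \<Longrightarrow> word_map f w ` K \<subseteq> K"
  using attractor by (intro word_map_image_subset) (auto simp: is_attractor_def)

lemma finite_words: "finite (words I n)"
  unfolding words_def by (rule finite_lists_length_eq[OF finite_I])

lemma words_Suc: "words I (Suc n) = (\<lambda>(i, w). i # w) ` (I \<times> words I n)"
  by (auto simp: words_def length_Suc_conv)

lemma sum_ratio_powr: "(\<Sum>w\<in>words I n. ratio c w powr t) = (\<Sum>i\<in>I. c i powr t) ^ n"
proof (induction n)
  case 0
  have "words I 0 = {[]}" by (auto simp: words_def)
  then show ?case by simp
next
  case (Suc n)
  have "(\<Sum>w\<in>words I (Suc n). ratio c w powr t)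
      = (\<Sum>(i, w)\<in>I \<times> words I n. ratio c (i # w) powr t)"
    unfolding words_Suc by (subst sum.reindex) (auto simp: inj_on_def case_prod_beta)
  also have "\<dots> = (\<Sum>(i, w)\<in>I \<times> words I n. c i powr t * ratio c w powr t)"
    using contractive_similarity ratio_pos
    by (intro sum.cong) (force simp: words_def intro!: powr_mult)+
  also have "\<dots> = (\<Sum>i\<in>I. c i powr t) * (\<Sum>w\<in>words I n. ratio c w powr t)"
    by (simp add: sum_product sum.cartesian_product)
  finally show ?case using Suc by simp
qed

definition cmin :: real where "cmin = Min (c ` I)"
definition cmax :: real where "cmax = Max (c ` I)"

lemma cmin_pos: "0 < cmin" and cmin_le: "i \<in> I \<Longrightarrow> cmin \<le> c i"
  and cmin_le_1: "cmin \<le> 1"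
proof -
  have "cmin \<in> c ` I"
    unfolding cmin_def using finite_I I_nonempty by (intro Min_in) auto
  then show "0 < cmin" "cmin \<le> 1" using contractive_similarity by force+
  show "i \<in> I \<Longrightarrow> cmin \<le> c i" unfolding cmin_def using finite_I by auto
qed

lemma cmax_bounds: "0 < cmax" "cmax < 1" and cmax_ge: "i \<in> I \<Longrightarrow> c i \<le> cmax"
proof -
  have "cmax \<in> c ` I"
    unfolding cmax_def using finite_I I_nonempty by (intro Max_in) auto
  then show "0 < cmax" "cmax < 1" using contractive_similarity by force+
  show "i \<in> I \<Longrightarrow> c i \<le> cmax" unfolding cmax_def using finite_I by auto
qed

lemma ratio_le_cmax_power: "set w \<subseteq> I \<Longrightarrow> ratio c w \<le> cmax ^ length w"
proof (induction w)
  case (Cons i w)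
  then show ?case
    using cmax_ge[of i] cmax_bounds ratio_pos[of w] by (auto intro!: mult_mono)
qed auto

lemma eventually_ratio_le:
  assumes "\<delta> > 0"
  shows "\<exists>n0. \<forall>n\<ge>n0. \<forall>w\<in>words I n. ratio c w \<le> \<delta>"
proof -
  obtain n0 where n0: "cmax ^ n0 < \<delta>"
    using real_arch_pow_inv[OF assms cmax_bounds(2)] by blast
  have "ratio c w \<le> \<delta>" if "n0 \<le> n" "w \<in> words I n" for n w
  proof -
    have "ratio c w \<le> cmax ^ n"
      using ratio_le_cmax_power[of w] that by (auto simp: words_def)
    also have "\<dots> \<le> cmax ^ n0"
      using cmax_bounds that(1) by (intro power_decreasing) auto
    finally show ?thesis using n0 by simp
  qed
  then show ?thesis by blast
qed

lemma ratio_stop_le: "set w \<subseteq> I \<Longrightarrow> ratio c w \<le> \<delta> \<Longrightarrow> ratio c (stop c \<delta> w) \<le> \<delta>"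
proof (induction w arbitrary: \<delta>)
  case (Cons i w)
  then show ?case
    using contractive_similarity[of i] Cons.IH[of "\<delta> / c i"] by (auto simp: field_simps)
qed auto

text \<open>Before its last letter was added, the ratio of a cut word exceeded \<open>\<delta>\<close>, and one letter costs at most a
  factor \<open>cmin\<close>. For \<open>\<delta> \<le> 1\<close> this also covers the empty word.\<close>

lemma ratio_stop_ge: "set w \<subseteq> I \<Longrightarrow> \<delta> \<le> 1 \<Longrightarrow> cmin * \<delta> \<le> ratio c (stop c \<delta> w)"
proof (induction w arbitrary: \<delta>)
  case Nil
  have "cmin * \<delta> \<le> cmin * 1" using Nil cmin_pos by (intro mult_left_mono) auto
  then show ?case using cmin_le_1 by simp
next
  case (Cons i w)
  have i: "i \<in> I" "0 < c i" using Cons.prems contractive_similarity[of i] by auto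
  have less: "cmin * \<delta> \<le> cmin" using Cons.prems cmin_pos by simp
  consider "\<delta> = 1" | "\<delta> < 1" "c i \<le> \<delta>" | "\<delta> < c i"
    using Cons.prems contractive_similarity[of i] by fastforce
  then show ?case
  proof cases
    case 2
    then show ?thesis using i less cmin_le[OF i(1)] by (simp add: divide_simps)
  next
    case 3
    then have "cmin * (\<delta> / c i) \<le> ratio c (stop c (\<delta> / c i) w)"
      using Cons i by (intro Cons.IH) auto
    with 3 i show ?thesis
      using contractive_similarity[of i] by (simp add: field_simps)
  qed (use cmin_le_1 in auto)
qed

text \<open>Where a word is cut depends only on the part that is kept. So the words with a given cut are all
  the extensions of it, and no cut word extends another one.\<close>

lemma stop_stop_append:
  "set w \<subseteq> I \<Longrightarrow> ratio c w \<le> \<delta> \<Longrightarrow> stop c \<delta> (stop c \<delta> w @ u) = stop c \<delta> w"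
proof (induction w arbitrary: \<delta>)
  case (Cons i w)
  then show ?case
    using contractive_similarity[of i] by (auto simp: field_simps)
qed auto

text \<open>Two cut words that differ branch at some letter, and there the open set condition separates
  their images.\<close>

lemma stop_images_disjoint:
  assumes V: "(\<Union>i\<in>I. f i ` V) \<subseteq> V" "disjoint_family_on (\<lambda>i. f i ` V) I"
    and "set v \<subseteq> I" "set w \<subseteq> I" "ratio c v \<le> \<delta>" "ratio c w \<le> \<delta>"
    and "word_map f (stop c \<delta> v) ` V \<inter> word_map f (stop c \<delta> w) ` V \<noteq> {}"
  shows "stop c \<delta> v = stop c \<delta> w"
  using assms(3-)
proof (induction v arbitrary: w \<delta>)
  case (Cons i v)
  show ?case
  proof (cases "1 \<le> \<delta>")
    case False
    with Cons.prems obtain j w' where w: "w = j # w'"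
      by (cases w) auto
    have ij: "i \<in> I" "j \<in> I" "0 < c i" using Cons.prems w contractive_similarity[of i] by auto
    obtain a b where a: "a \<in> V" and b: "b \<in> V"
      and eq: "f i (word_map f (stop c (\<delta> / c i) v) a) = f j (word_map f (stop c (\<delta> / c j) w') b)"
      using Cons.prems(5) False unfolding w by auto
    have stop_in: "set (stop c d z) \<subseteq> I" if "set z \<subseteq> I" for d z
      using set_stop_subset[of c d z] that by blast
    have "word_map f (stop c (\<delta> / c i) v) a \<in> V" "word_map f (stop c (\<delta> / c j) w') b \<in> V"
      using a b Cons.prems w word_map_image_subset[OF V(1) stop_in]
      by (metis image_subset_iff set_subset_Cons subset_trans)+
    then have "i = j"
      using eq V(2) ij by (auto simp: disjoint_family_on_def)
    moreover have "inj (f i)"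
      using contractive_similarity[OF ij(1)] by (intro injI) (metis dist_eq_0_iff
        less_irrefl mult_eq_0_iff similarity_def)
    ultimately have "word_map f (stop c (\<delta> / c i) v) a = word_map f (stop c (\<delta> / c i) w') b"
      using eq by (auto dest: injD)
    then have "stop c (\<delta> / c i) v = stop c (\<delta> / c i) w'"
      using Cons.prems w ij \<open>i = j\<close> a b
      by (intro Cons.IH) (auto simp: field_simps)
    then show ?thesis using False w \<open>i = j\<close> by simp
  qed auto
qed auto

end

section \<open>The natural mass distribution\<close>

locale osc_ifs = ifs I f c K
  for I :: "'i set" and f :: "'i \<Rightarrow> 'a::euclidean_space \<Rightarrow> 'a" and c K +
  fixes s :: real
  assumes osc: "open_set_condition I f"
    and moran: "(\<Sum>i\<in>I. c i powr s) = 1"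
begin

lemma s_nonneg: "0 \<le> s"
proof (rule ccontr)
  assume "\<not> 0 \<le> s"
  obtain i where i: "i \<in> I" using I_nonempty by blast
  have "1 < c i powr s"
    using contractive_similarity[OF i] \<open>\<not> 0 \<le> s\<close> powr_less_mono2_neg[of s "c i" 1] by auto
  also have "\<dots> \<le> (\<Sum>i\<in>I. c i powr s)"
    using finite_I i by (intro member_le_sum) auto
  finally show False using moran by simp
qed

lemma sum_ratio_powr_s: "(\<Sum>w\<in>words I n. ratio c w powr s) = 1"
  by (simp add: sum_ratio_powr moran)

text \<open>The words that are cut to \<open>v\<close> are the words \<open>v @ u\<close> with \<open>u\<close> arbitrary of the remaining length, and
  the weights of these \<open>u\<close> add up to \<open>1\<close>.\<close>

lemma sum_ratio_powr_stop_fiber: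
  assumes w: "w \<in> words I n" "ratio c w \<le> \<delta>"
  shows "(\<Sum>w'\<in>{w' \<in> words I n. stop c \<delta> w' = stop c \<delta> w}. ratio c w' powr s)
    = ratio c (stop c \<delta> w) powr s"
proof -
  define v where "v = stop c \<delta> w"
  obtain u where u: "w = v @ u"
    unfolding v_def by (metis stop_append)
  have vI: "set v \<subseteq> I" using w u by (auto simp: words_def)
  have "{w' \<in> words I n. stop c \<delta> w' = v} = (@) v ` words I (n - length v)"
  proof (intro equalityI subsetI)
    fix w' assume "w' \<in> {w' \<in> words I n. stop c \<delta> w' = v}"
    then have w': "w' \<in> words I n" "stop c \<delta> w' = v" by auto
    then obtain u' where "w' = v @ u'"
      by (metis stop_append)
    with w' show "w' \<in> (@) v ` words I (n - length v)"
      by (auto simp: words_def)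
  next
    fix w' assume "w' \<in> (@) v ` words I (n - length v)"
    then obtain u' where u': "w' = v @ u'" "u' \<in> words I (n - length v)" by blast
    moreover have "length v \<le> n" using w u by (auto simp: words_def)
    moreover have "stop c \<delta> (v @ u') = v"
      using w unfolding v_def by (intro stop_stop_append) (auto simp: words_def)
    ultimately show "w' \<in> {w' \<in> words I n. stop c \<delta> w' = v}"
      using vI by (auto simp: words_def)
  qed
  then have "(\<Sum>w'\<in>{w' \<in> words I n. stop c \<delta> w' = v}. ratio c w' powr s)
      = (\<Sum>u\<in>words I (n - length v). ratio c (v @ u) powr s)"
    by (simp add: sum.reindex inj_on_def)
  also have "\<dots> = (\<Sum>u\<in>words I (n - length v). ratio c v powr s * ratio c u powr s)"
    using ratio_pos vI by (intro sum.cong) (force simp: words_def intro!: powr_mult)+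
  also have "\<dots> = ratio c v powr s"
    by (simp add: sum_ratio_powr_s flip: sum_distrib_left)
  finally show ?thesis by (simp add: v_def)
qed

lemma sum_ratio_powr_stop:
  assumes "\<And>w. w \<in> words I n \<Longrightarrow> ratio c w \<le> \<delta>"
  shows "(\<Sum>v\<in>stop c \<delta> ` words I n. ratio c v powr s) = 1"
proof -
  have "1 = (\<Sum>v\<in>stop c \<delta> ` words I n.
      \<Sum>w\<in>{w \<in> words I n. stop c \<delta> w = v}. ratio c w powr s)"
    using sum.image_gen[OF finite_words, of "\<lambda>w. ratio c w powr s" n "stop c \<delta>"]
    by (simp add: sum_ratio_powr_s)
  also have "\<dots> = (\<Sum>v\<in>stop c \<delta> ` words I n. ratio c v powr s)"
    using assms by (intro sum.cong) (auto simp: sum_ratio_powr_stop_fiber)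
  finally show ?thesis by simp
qed

text \<open>Let \<open>v0\<close> be the centre of a ball of radius \<open>r\<close> inside the open set \<open>V\<close>. For different cut words \<open>v\<close>, the
  images of \<open>V\<close> are disjoint, so the points \<open>word_map f v v0\<close> have distance at least \<open>ratio c v * r\<close>, which
  is comparable to \<open>d\<close>. Those that belong to words whose image meets \<open>U\<close> lie within distance \<open>L * d\<close> of \<open>U\<close>, where
  \<open>L\<close> depends only on \<open>v0\<close> and \<open>K\<close>. So there are at most \<open>M\<close> of them, and each carries
  weight at most \<open>d powr s\<close>.\<close>

lemma mass_bound:
  "\<exists>N>0. \<forall>x\<in>K. \<forall>d>0. \<forall>U. (\<forall>a\<in>U. \<forall>b\<in>U. dist a b \<le> d) \<longrightarrow>
    (\<forall>\<^sub>F n in sequentially.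
       (\<Sum>w\<in>{w \<in> words I n. word_map f w x \<in> U}. ratio c w powr s) \<le> N * d powr s)"
proof -
  obtain V where V: "V \<noteq> {}" "open V" "(\<Union>i\<in>I. f i ` V) \<subseteq> V"
      "disjoint_family_on (\<lambda>i. f i ` V) I"
    using osc unfolding open_set_condition_def by blast
  obtain v0 r where r: "r > 0" "ball v0 r \<subseteq> V" and v0: "v0 \<in> V"
    using V(1,2) by (meson ex_in_conv open_contains_ball)
  obtain R where R: "\<And>z. z \<in> K \<Longrightarrow> dist v0 z \<le> R"
    using K_bounded unfolding bounded_any_center[where a = v0] by blast
  obtain z0 where "z0 \<in> K" using K_nonempty by blast
  with R[of z0] have "R \<ge> 0" by (meson order_trans zero_le_dist)
  define L where "L = R + 1"
  have L: "L > 0" using \<open>R \<ge> 0\<close> by (simp add: L_def)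
  \<comment> \<open>The separation \<open>cmin * d * r\<close> expressed in units of the radius \<open>L * d\<close>.\<close>
  define \<epsilon> where "\<epsilon> = cmin * r / L"
  have \<epsilon>: "\<epsilon> > 0" using cmin_pos r L by (simp add: \<epsilon>_def)
  obtain M where M: "M > 0" and sep:
    "\<forall>(y :: 'a) r S. r > 0 \<longrightarrow> S \<subseteq> cball y r \<longrightarrow>
       (\<forall>a\<in>S. \<forall>b\<in>S. a \<noteq> b \<longrightarrow> \<epsilon> * r \<le> dist a b) \<longrightarrow> finite S \<and> card S \<le> M"
    using separated_card_bounded[OF \<epsilon>] by blast
  have "\<forall>\<^sub>F n in sequentially.
      (\<Sum>w\<in>{w \<in> words I n. word_map f w x \<in> U}. ratio c w powr s) \<le> real M * d powr s"
    if x: "x \<in> K" and d: "d > 0" and U: "\<And>a b. a \<in> U \<Longrightarrow> b \<in> U \<Longrightarrow> dist a b \<le> d"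
    for x d U
  proof (cases "d < 1")
    case False
    have "(\<Sum>w\<in>{w \<in> words I n. word_map f w x \<in> U}. ratio c w powr s) \<le> real M * d powr s" for n
    proof -
      have "(\<Sum>w\<in>{w \<in> words I n. word_map f w x \<in> U}. ratio c w powr s) \<le> 1"
        using sum_mono2[OF finite_words, of "{w \<in> words I n. word_map f w x \<in> U}" n
            "\<lambda>w. ratio c w powr s"] by (auto simp: sum_ratio_powr_s)
      \<comment> \<open>The words are cut only at scales below \<open>1\<close>; for \<open>d \<ge> 1\<close> the total weight is small enough.\<close>
      also have "1 \<le> real M * d powr s"
        using M False s_nonneg mult_mono[of 1 "real M" 1 "d powr s"]
        by (auto simp: ge_one_powr_ge_zero)
      finally show ?thesis by simp
    qed
    then show ?thesis by simp
  next
    case True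
    obtain n0 where n0: "\<And>n w. n0 \<le> n \<Longrightarrow> w \<in> words I n \<Longrightarrow> ratio c w \<le> d"
      using eventually_ratio_le[OF d] by blast
    have "(\<Sum>w\<in>{w \<in> words I n. word_map f w x \<in> U}. ratio c w powr s) \<le> real M * d powr s"
      if n: "n0 \<le> n" for n
    proof -
      define A where "A = {w \<in> words I n. word_map f w x \<in> U}"
      define S where "S = stop c d ` A"
      define p where "p v = word_map f v v0" for v
      have finA: "finite A" using finite_words by (simp add: A_def)
      have S: "set v \<subseteq> I" "ratio c v \<le> d" "cmin * d \<le> ratio c v" if v: "v \<in> S" for v
      proof -
        obtain w where w: "w \<in> A" "v = stop c d w" using v unfolding S_def by blast
        then have w': "set w \<subseteq> I" "ratio c w \<le> d" using n0[OF n] by (auto simp: A_def words_def)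
        show "ratio c v \<le> d" using w w' by (simp add: ratio_stop_le)
        show "cmin * d \<le> ratio c v" using w w' True by (simp add: ratio_stop_ge)
        show "set v \<subseteq> I" using w w' set_stop_subset[of c d w] by auto
      qed
      have far: "cmin * d * r \<le> dist (p v) (p v')" if "v \<in> S" "v' \<in> S" "v \<noteq> v'" for v v'
      proof -
        have "word_map f v ` V \<inter> word_map f v' ` V = {}"
          using that stop_images_disjoint[OF V(3,4)] n0[OF n]
          unfolding S_def A_def words_def by blast
        then have "p v' \<notin> word_map f v ` V"
          using v0 by (auto simp: p_def)
        then have "p v' \<notin> ball (p v) (ratio c v * r)"
          using image_mono[OF r(2), of "word_map f v"]
            similarity_ball[OF similarity_word_map[OF S(1)[OF that(1)]], of v0 r]
          unfolding p_def by blast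
        then have "ratio c v * r \<le> dist (p v) (p v')" by simp
        moreover have "cmin * d * r \<le> ratio c v * r"
          using S(3)[OF that(1)] r by (simp add: mult_right_mono)
        ultimately show ?thesis by simp
      qed
      have card: "card S \<le> M"
      proof (cases "A = {}")
        case False
        then obtain y where y: "y \<in> U" by (auto simp: A_def)
        have "p v \<in> cball y (L * d)" if v: "v \<in> S" for v
        proof -
          obtain w where w: "w \<in> A" "v = stop c d w" using v unfolding S_def by blast
          obtain u where u: "w = v @ u" using w by (metis stop_append)
          have "word_map f u x \<in> K"
            using word_map_image_K[of u] w(1) x u by (auto simp: A_def words_def)
          then have "dist (word_map f u x) v0 \<le> R"
            by (subst dist_commute) (rule R)
          then have "dist (word_map f w x) (p v) \<le> ratio c v * R"
            using dist_word_map[OF S(1)[OF v]] ratio_pos[OF S(1)[OF v]]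
            by (simp add: u p_def word_map_append)
          also have "\<dots> \<le> d * R"
            using S(2)[OF v] \<open>R \<ge> 0\<close> by (rule mult_right_mono)
          moreover have "dist y (word_map f w x) \<le> d"
            using w(1) y by (intro U) (auto simp: A_def)
          ultimately have "dist y (p v) \<le> d + d * R"
            using dist_triangle[of y "p v" "word_map f w x"] by simp
          then show ?thesis by (simp add: L_def algebra_simps)
        qed
        then have "p ` S \<subseteq> cball y (L * d)" by blast
        moreover have "\<epsilon> * (L * d) \<le> dist a b" if "a \<in> p ` S" "b \<in> p ` S" "a \<noteq> b" for a b
          using that far L by (auto simp: \<epsilon>_def mult_ac)
        ultimately have "card (p ` S) \<le> M"
          using sep[rule_format, of "L * d" "p ` S" y] L d by auto
        moreover have "inj_on p S"
        proof (rule inj_onI, rule ccontr)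
          fix v v' assume v: "v \<in> S" "v' \<in> S" "p v = p v'" "v \<noteq> v'"
          have "0 < cmin * d * r" using cmin_pos d r by simp
          with far[OF v(1,2,4)] v(3) show False by simp
        qed
        ultimately show ?thesis by (simp add: card_image)
      qed (simp add: S_def)
      have "(\<Sum>w\<in>A. ratio c w powr s) = (\<Sum>v\<in>S. \<Sum>w\<in>{w \<in> A. stop c d w = v}. ratio c w powr s)"
        unfolding S_def by (rule sum.image_gen[OF finA])
      also have "\<dots> \<le> (\<Sum>v\<in>S. ratio c v powr s)"
      proof (rule sum_mono)
        fix v assume "v \<in> S"
        then obtain w where w: "w \<in> words I n" "v = stop c d w" by (auto simp: S_def A_def)
        have "(\<Sum>w\<in>{w \<in> A. stop c d w = v}. ratio c w powr s)
            \<le> (\<Sum>w\<in>{w \<in> words I n. stop c d w = v}. ratio c w powr s)"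
          using finite_words by (intro sum_mono2) (auto simp: A_def)
        also have "\<dots> = ratio c v powr s"
          using sum_ratio_powr_stop_fiber[OF w(1) n0[OF n w(1)]] w(2) by simp
        finally show "(\<Sum>w\<in>{w \<in> A. stop c d w = v}. ratio c w powr s) \<le> ratio c v powr s" .
      qed
      also have "\<dots> \<le> (\<Sum>v\<in>S. d powr s)"
        using S ratio_pos s_nonneg by (intro sum_mono powr_mono2) (auto intro: less_imp_le)
      also have "\<dots> \<le> real M * d powr s"
        using card by (simp add: mult_right_mono)
      finally show ?thesis by (simp add: A_def)
    qed
    then show ?thesis by (auto simp: eventually_sequentially)
  qed
  then show ?thesis
    using M by (intro exI[of _ "real M"] conjI ballI allI impI) auto
qed

text \<open>For \<open>n\<close> large enough for all the finitely many \<open>U j\<close>, every word of length \<open>n\<close> is charged to a set that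
  contains the image of a chosen point of \<open>K\<close>; add up the weights.\<close>

lemma finite_cover_bound:
  "\<exists>N>0. \<forall>(J :: 'j set) d U. finite J \<longrightarrow> K \<subseteq> (\<Union>j\<in>J. U j) \<longrightarrow> (\<forall>j\<in>J. d j > 0) \<longrightarrow>
    (\<forall>j\<in>J. \<forall>a\<in>U j. \<forall>b\<in>U j. dist a b \<le> d j) \<longrightarrow> 1 \<le> N * (\<Sum>j\<in>J. d j powr s)"
proof -
  obtain N where N: "N > 0" and mass: "\<forall>x\<in>K. \<forall>d>0. \<forall>U. (\<forall>a\<in>U. \<forall>b\<in>U. dist a b \<le> d) \<longrightarrow>
    (\<forall>\<^sub>F n in sequentially.
       (\<Sum>w\<in>{w \<in> words I n. word_map f w x \<in> U}. ratio c w powr s) \<le> N * d powr s)"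
    using mass_bound by blast
  obtain x where x: "x \<in> K" using K_nonempty by blast
  have "1 \<le> N * (\<Sum>j\<in>J. d j powr s)"
    if J: "finite J" and cov: "K \<subseteq> (\<Union>j\<in>J. U j)" and d: "\<And>j. j \<in> J \<Longrightarrow> d j > 0"
      and U: "\<And>j a b. j \<in> J \<Longrightarrow> a \<in> U j \<Longrightarrow> b \<in> U j \<Longrightarrow> dist a b \<le> d j"
    for J :: "'j set" and d U
  proof -
    have "\<forall>\<^sub>F n in sequentially. \<forall>j\<in>J.
        (\<Sum>w\<in>{w \<in> words I n. word_map f w x \<in> U j}. ratio c w powr s) \<le> N * d j powr s"
      using mass[rule_format, OF x d U] by (intro eventually_ball_finite[OF J] ballI)
    then obtain n where n: "\<And>j. j \<in> J \<Longrightarrow>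
        (\<Sum>w\<in>{w \<in> words I n. word_map f w x \<in> U j}. ratio c w powr s) \<le> N * d j powr s"
      using eventually_happens'[OF sequentially_bot] by blast
    have "1 = (\<Sum>w\<in>words I n. ratio c w powr s)"
      by (simp add: sum_ratio_powr_s)
    also have "\<dots> \<le> (\<Sum>w\<in>words I n. \<Sum>j\<in>J. if word_map f w x \<in> U j then ratio c w powr s else 0)"
    proof (rule sum_mono)
      fix w assume "w \<in> words I n"
      then have "word_map f w x \<in> K"
        using word_map_image_K[of w] x by (auto simp: words_def)
      then obtain j where j: "j \<in> J" "word_map f w x \<in> U j" using cov by blast
      then show "ratio c w powr s
          \<le> (\<Sum>j\<in>J. if word_map f w x \<in> U j then ratio c w powr s else 0)"
        using member_le_sum[of j J "\<lambda>j. if word_map f w x \<in> U j then ratio c w powr s else 0"] J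
        by auto
    qed
    also have "\<dots> = (\<Sum>j\<in>J. \<Sum>w\<in>{w \<in> words I n. word_map f w x \<in> U j}. ratio c w powr s)"
      by (subst sum.swap) (simp add: sum.inter_filter finite_words)
    also have "\<dots> \<le> (\<Sum>j\<in>J. N * d j powr s)"
      using n by (rule sum_mono)
    finally show ?thesis by (simp add: sum_distrib_left)
  qed
  then show ?thesis
    using N by (intro exI[of _ N] conjI allI impI) auto
qed

end

section \<open>The Hausdorff measure is positive\<close>

lemma finite_sum_le_infsum_ennreal:
  fixes g :: "'i \<Rightarrow> ennreal"
  assumes "finite F" "F \<subseteq> J"
  shows "sum g F \<le> infsum g J"
  using assms by (auto simp: nonneg_infsum_complete intro!: SUP_upper)

context osc_ifs
begin

text \<open>A countable covering is reduced to a finite one by enlarging each set \<open>U j\<close> to an open set. The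
  enlarged diameter \<open>d j\<close> is chosen such that \<open>d j powr s\<close> exceeds \<open>diam\<^sup>s\<close> of \<open>U j\<close> by \<open>\<eta> / 2\<^sup>j\<^sup>+\<^sup>1\<close>; the excess
  sums up to at most \<open>\<eta>\<close>, which is at most half of what the finite covering has to cost. For \<open>s = 0\<close> no such \<open>d j\<close>
  exists, but then the sum counts the sets of the covering.\<close>

lemma hausdorff_meas_pos: "0 < hausdorff_meas s K"
proof -
  obtain N where N: "N > 0" and bound:
    "\<forall>(J :: nat set) d U. finite J \<longrightarrow> K \<subseteq> (\<Union>j\<in>J. U j) \<longrightarrow> (\<forall>j\<in>J. d j > 0) \<longrightarrow>
      (\<forall>j\<in>J. \<forall>a\<in>U j. \<forall>b\<in>U j. dist a b \<le> d j) \<longrightarrow> 1 \<le> N * (\<Sum>j\<in>J. d j powr s)"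
    using finite_cover_bound by blast
  define \<eta> where "\<eta> = min 1 (1 / (2 * N))"
  have \<eta>: "\<eta> > 0" "\<eta> \<le> 1" "2 * N * \<eta> \<le> 1"
    using N by (auto simp: \<eta>_def min_def field_simps)
  have "ennreal \<eta> \<le> cover_sum s \<U>" if \<U>: "\<U> \<in> covers_by {U. ediam U \<le> ennreal 1} K" for \<U>
  proof -
    obtain J U where JU: "\<U> = (J, U)" by (cases \<U>)
    have cov: "K \<subseteq> (\<Union>j\<in>J. U j)" and diam: "\<And>j. j \<in> J \<Longrightarrow> ediam (U j) \<le> ennreal 1"
      using \<U> by (auto simp: covers_by_def JU)
    have partial: "(\<Sum>j\<in>F. epower (ediam (U j)) s) \<le> cover_sum s \<U>" if "finite F" "F \<subseteq> J" for F
      using that by (simp add: cover_sum_def JU finite_sum_le_infsum_ennreal)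
    show ?thesis
    proof (cases "s = 0")
      case True
      obtain j where "j \<in> J" using cov K_nonempty by blast
      then have "1 \<le> cover_sum s \<U>"
        using partial[of "{j}"] True by (simp add: epower_def)
      moreover have "ennreal \<eta> \<le> 1" using \<eta> by simp
      ultimately show ?thesis by (rule order_trans[rotated])
    next
      case False
      then have s: "s > 0" using s_nonneg by simp
      define D where "D j = diameter (U j)" for j
      have bdd: "bounded (U j)" if "j \<in> J" for j
        using diam[OF that] by (auto simp: ediam_def top_unique split: if_splits)
      have D: "D j \<ge> 0" "epower (ediam (U j)) s = ennreal (D j powr s)" if "j \<in> J" for j
        using bdd[OF that] False
        by (auto simp: D_def diameter_ge_0 ediam_def epower_ennreal)
      \<comment> \<open>The term \<open>\<eta> / 2\<^sup>j\<^sup>+\<^sup>1\<close> makes \<open>d j\<close> positive, and larger than \<open>D j\<close>, even if \<open>U j\<close> is a single point.\<close>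
      define d where "d j = (D j powr s + \<eta> * (1/2) ^ Suc j) powr (1 / s)" for j
      have pos: "D j powr s + \<eta> * (1/2) ^ Suc j > 0" for j
        using \<eta> by (intro add_nonneg_pos) auto
      have d_powr: "d j powr s = D j powr s + \<eta> * (1/2) ^ Suc j" for j
        using pos[of j] s by (simp add: d_def powr_powr)
      have d_gt: "D j < d j" if "j \<in> J" for j
      proof -
        have "D j = (D j powr s) powr (1 / s)"
          using D(1)[OF that] s by (simp add: powr_powr)
        also have "\<dots> < d j"
          unfolding d_def using \<eta> s by (intro powr_less_mono2) auto
        finally show ?thesis .
      qed
      define e where "e j = (d j - D j) / 2" for j
      define W where "W j = (\<Union>y\<in>U j. ball y (e j))" for j
      have "K \<subseteq> (\<Union>j\<in>J. W j)"
      proof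
        fix x assume "x \<in> K"
        then obtain j where j: "j \<in> J" "x \<in> U j" using cov by blast
        moreover have "0 < e j" using d_gt[OF j(1)] by (simp add: e_def)
        ultimately show "x \<in> (\<Union>j\<in>J. W j)" by (force simp: W_def)
      qed
      then obtain F where F: "F \<subseteq> J" "finite F" "K \<subseteq> (\<Union>j\<in>F. W j)"
        by (rule compactE_image[OF K_compact, rotated]) (auto simp: W_def)
      have "dist a b \<le> d j" if "j \<in> F" "a \<in> W j" "b \<in> W j" for j a b
      proof -
        obtain x y where xy: "x \<in> U j" "y \<in> U j" "dist x a < e j" "dist y b < e j"
          using \<open>a \<in> W j\<close> \<open>b \<in> W j\<close> by (auto simp: W_def)
        have "dist x y \<le> D j"
          unfolding D_def using xy bdd F(1) \<open>j \<in> F\<close> by (intro diameter_bounded_bound) auto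
        moreover have "dist a b \<le> dist x a + dist x y + dist y b"
          using dist_triangle[of a b x] dist_triangle[of x b y] by (simp add: dist_commute)
        ultimately show ?thesis using xy by (simp add: e_def field_simps)
      qed
      moreover have "d j > 0" if "j \<in> F" for j
        using d_gt[of j] D(1)[of j] F(1) that by force
      ultimately have "1 \<le> N * (\<Sum>j\<in>F. d j powr s)"
        using bound[rule_format, of F W d] F by blast
      moreover have "(\<Sum>j\<in>F. d j powr s) = (\<Sum>j\<in>F. D j powr s) + \<eta> * (\<Sum>j\<in>F. (1/2) ^ Suc j)"
        by (simp only: d_powr sum.distrib sum_distrib_left)
      moreover have "\<eta> * (\<Sum>j\<in>F. (1/2 :: real) ^ Suc j) \<le> \<eta> * 1"
      proof -
        have "(\<Sum>j\<in>F. (1/2 :: real) ^ Suc j) \<le> (\<Sum>j. (1/2) ^ Suc j)"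
          using F(2) power_half_series by (intro sum_le_suminf) (auto simp: sums_iff)
        also have "\<dots> = 1" using power_half_series by (simp only: sums_iff)
        finally show ?thesis using \<eta>(1) by (intro mult_left_mono) auto
      qed
      ultimately have "(\<Sum>j\<in>F. d j powr s) \<le> (\<Sum>j\<in>F. D j powr s) + \<eta>" by linarith
      then have "N * (\<Sum>j\<in>F. d j powr s) \<le> N * ((\<Sum>j\<in>F. D j powr s) + \<eta>)"
        using N by (intro mult_left_mono) auto
      with \<open>1 \<le> N * (\<Sum>j\<in>F. d j powr s)\<close> have "1 \<le> N * ((\<Sum>j\<in>F. D j powr s) + \<eta>)"
        by linarith
      moreover have "N * \<eta> \<le> 1 / 2" using \<eta> by simp
      ultimately have "N * \<eta> \<le> N * (\<Sum>j\<in>F. D j powr s)"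
        by (simp add: distrib_left)
      then have "\<eta> \<le> (\<Sum>j\<in>F. D j powr s)"
        using N by simp
      then have "ennreal \<eta> \<le> (\<Sum>j\<in>F. ennreal (D j powr s))"
        by (simp add: sum_ennreal ennreal_leI)
      also have "\<dots> = (\<Sum>j\<in>F. epower (ediam (U j)) s)"
        using D(2) F(1) by (intro sum.cong) auto
      also have "\<dots> \<le> cover_sum s \<U>"
        using F by (intro partial) auto
      finally show ?thesis .
    qed
  qed
  then have "ennreal \<eta> \<le> hausdorff_pre 1 s K"
    unfolding hausdorff_pre_def by (rule INF_greatest)
  also have "\<dots> \<le> hausdorff_meas s K"
    unfolding hausdorff_meas_eq_SUP by (intro SUP_upper) auto
  finally have "ennreal \<eta> \<le> hausdorff_meas s K" .
  moreover have "0 < ennreal \<eta>" using \<eta>(1) by simp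
  ultimately show ?thesis by (rule less_le_trans[rotated])
qed

end

section \<open>The box dimension\<close>

definition is_packing :: "real \<Rightarrow> 'a::metric_space set \<Rightarrow> 'a set \<Rightarrow> bool" where
  "is_packing \<delta> F C \<longleftrightarrow> finite C \<and> C \<subseteq> F \<and> disjoint_family_on (\<lambda>x. cball x \<delta>) C"

text \<open>If the centres are at distance at most \<open>2 * \<delta>\<close>, both balls contain their midpoint.\<close>

lemma cball_disjoint_iff:
  fixes x y :: "'a::real_normed_vector"
  shows "cball x \<delta> \<inter> cball y \<delta> = {} \<longleftrightarrow> 2 * \<delta> < dist x y"
proof
  assume *: "cball x \<delta> \<inter> cball y \<delta> = {}"
  show "2 * \<delta> < dist x y"
  proof (rule ccontr)
    assume "\<not> 2 * \<delta> < dist x y"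
    then have "midpoint x y \<in> cball x \<delta> \<inter> cball y \<delta>"
      by (auto simp: dist_midpoint)
    with * show False by blast
  qed
next
  assume *: "2 * \<delta> < dist x y"
  have "False" if "z \<in> cball x \<delta>" "z \<in> cball y \<delta>" for z
    using that dist_triangle[of x y z] * by (simp add: dist_commute)
  then show "cball x \<delta> \<inter> cball y \<delta> = {}" by blast
qed

lemma is_packing_iff:
  fixes F :: "'a::real_normed_vector set"
  shows "is_packing \<delta> F C \<longleftrightarrow>
    finite C \<and> C \<subseteq> F \<and> (\<forall>x\<in>C. \<forall>y\<in>C. x \<noteq> y \<longrightarrow> 2 * \<delta> < dist x y)"
  by (auto simp: is_packing_def disjoint_family_on_def cball_disjoint_iff)

text \<open>A packing with the largest possible number of balls cannot be extended, so every point of \<open>F\<close> is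
  within \<open>2 * \<delta>\<close> of one of its centres.\<close>

lemma maximal_packing:
  fixes F :: "'a::real_normed_vector set"
  assumes "0 \<le> \<delta>" and "\<And>C. is_packing \<delta> F C \<Longrightarrow> card C \<le> b"
  shows "\<exists>C. is_packing \<delta> F C \<and> packing_number \<delta> F = of_nat (card C) \<and>
    F \<subseteq> (\<Union>x\<in>C. cball x (2 * \<delta>))"
proof -
  have "is_packing \<delta> F {}" by (simp add: is_packing_iff)
  then obtain C where C: "is_packing \<delta> F C" and max: "\<And>C'. is_packing \<delta> F C' \<Longrightarrow> card C' \<le> card C"
    using ex_has_greatest_nat[of "is_packing \<delta> F" "{}" card "Suc b"] assms(2)
    by (auto simp: less_Suc_eq_le)
  have "packing_number \<delta> F = of_nat (card C)"
    unfolding packing_number_def is_packing_def[symmetric]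
  proof (rule antisym)
    show "(SUP C\<in>{C. is_packing \<delta> F C}. ecount C) \<le> of_nat (card C)"
      using max by (intro SUP_least) (auto simp: ecount_def is_packing_def)
    show "of_nat (card C) \<le> (SUP C\<in>{C. is_packing \<delta> F C}. ecount C)"
      using C by (intro SUP_upper2[of C]) (auto simp: ecount_def is_packing_def)
  qed
  moreover have "x \<in> (\<Union>y\<in>C. cball y (2 * \<delta>))" if x: "x \<in> F" for x
  proof (rule ccontr)
    assume "x \<notin> (\<Union>y\<in>C. cball y (2 * \<delta>))"
    then have far: "\<And>y. y \<in> C \<Longrightarrow> 2 * \<delta> < dist y x" by auto
    then have "x \<notin> C" using assms(1) by force
    have "is_packing \<delta> F (insert x C)"
      using C x far by (auto simp: is_packing_iff dist_commute)
    from max[OF this] \<open>x \<notin> C\<close> C show False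
      by (simp add: is_packing_iff)
  qed
  ultimately show ?thesis using C by blast
qed

context osc_ifs
begin

lemma K_eq_Union_words: "K = (\<Union>w\<in>words I n. word_map f w ` K)"
proof -
  have "\<Union>(level_sets (natural_structure I f K) n) = K"
    using fractal_structure_natural_structure[OF attractor] by (simp add: fractal_structure_def)
  then show ?thesis
    by (auto simp: level_sets_def natural_structure_def words_def)
qed

text \<open>Cut the words at the scale \<open>\<eta> = 2 * \<delta> / D\<close>. Then the image of \<open>K\<close> under a cut word has diameter at
  most \<open>2 * \<delta>\<close> and contains at most one centre of a packing; the number of cut words is at most a
  constant times \<open>\<delta> powr - s\<close> because their weights add up to \<open>1\<close> and are comparable to
  \<open>\<delta> powr s\<close>. The summand \<open>1\<close> in \<open>D\<close> keeps \<open>D\<close> positive if \<open>K\<close> is a single point.\<close>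

lemma packing_upper_bound:
  "\<exists>B>0. \<exists>\<delta>0>0. \<forall>\<delta> C. 0 < \<delta> \<longrightarrow> \<delta> \<le> \<delta>0 \<longrightarrow> is_packing \<delta> K C \<longrightarrow> real (card C) \<le> B * \<delta> powr - s"
proof -
  define D where "D = diameter K + 1"
  have D: "D > 0" using diameter_ge_0[OF K_bounded] by (simp add: D_def)
  have "real (card C) \<le> (cmin * 2 / D) powr - s * \<delta> powr - s"
    if \<delta>: "0 < \<delta>" "\<delta> \<le> D / 2" and C: "is_packing \<delta> K C" for \<delta> C
  proof -
    define \<eta> where "\<eta> = 2 * \<delta> / D"
    have \<eta>: "\<eta> > 0" "\<eta> \<le> 1" using \<delta> D by (auto simp: \<eta>_def field_simps)
    obtain n where n: "\<And>w. w \<in> words I n \<Longrightarrow> ratio c w \<le> \<eta>"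
      using eventually_ratio_le[OF \<eta>(1)] by blast
    define T where "T = stop c \<eta> ` words I n"
    have T: "set v \<subseteq> I" "ratio c v \<le> \<eta>" "cmin * \<eta> \<le> ratio c v" if v: "v \<in> T" for v
    proof -
      obtain w where w: "w \<in> words I n" "v = stop c \<eta> w" using v unfolding T_def by blast
      then have w': "set w \<subseteq> I" "ratio c w \<le> \<eta>" using n by (auto simp: words_def)
      show "set v \<subseteq> I" using w w' set_stop_subset[of c \<eta> w] by auto
      show "ratio c v \<le> \<eta>" using w w' by (simp add: ratio_stop_le)
      show "cmin * \<eta> \<le> ratio c v" using w w' \<eta> by (simp add: ratio_stop_ge)
    qed
    have "\<forall>x\<in>C. \<exists>v\<in>T. x \<in> word_map f v ` K"
    proof
      fix x assume "x \<in> C"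
      then have "x \<in> K" using C by (auto simp: is_packing_iff)
      then obtain w z where w: "w \<in> words I n" "x = word_map f w z" "z \<in> K"
        using K_eq_Union_words[of n] by blast
      define v where "v = stop c \<eta> w"
      obtain u where u: "w = v @ u" unfolding v_def by (metis stop_append)
      have "set u \<subseteq> I" using w(1) by (auto simp: u words_def)
      then have "word_map f u z \<in> K" using word_map_image_K w(3) by blast
      moreover have "x = word_map f v (word_map f u z)"
        by (simp add: w(2) u word_map_append)
      ultimately have "x \<in> word_map f v ` K" by blast
      moreover have "v \<in> T" using w(1) by (simp add: v_def T_def)
      ultimately show "\<exists>v\<in>T. x \<in> word_map f v ` K" by blast
    qed
    then obtain h where "\<forall>x\<in>C. h x \<in> T \<and> x \<in> word_map f (h x) ` K"
      using bchoice[of C "\<lambda>x v. v \<in> T \<and> x \<in> word_map f v ` K"] by blast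
    then have h: "h x \<in> T \<and> x \<in> word_map f (h x) ` K" if "x \<in> C" for x
      using that by blast
    have "inj_on h C"
    proof (rule inj_onI, rule ccontr)
      fix x y assume xy: "x \<in> C" "y \<in> C" "h x = h y" "x \<noteq> y"
      define v where "v = h x"
      have v: "v \<in> T" "x \<in> word_map f v ` K" "y \<in> word_map f v ` K"
        using h[OF xy(1)] h[OF xy(2)] xy(3) by (simp_all add: v_def)
      then obtain a b where ab: "a \<in> K" "b \<in> K" "x = word_map f v a" "y = word_map f v b"
        by blast
      have "dist x y = ratio c v * dist a b"
        unfolding ab(3,4) using v(1) by (intro dist_word_map T(1))
      also have "\<dots> \<le> \<eta> * D"
        using T(2)[OF v(1)] diameter_bounded_bound[OF K_bounded ab(1,2)] \<eta>(1)
        by (intro mult_mono) (auto simp: D_def)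
      also have "\<dots> = 2 * \<delta>" using D by (simp add: \<eta>_def)
      finally show False using C xy by (force simp: is_packing_iff)
    qed
    moreover have finT: "finite T" using finite_words by (simp add: T_def)
    ultimately have "card C \<le> card T"
      using h by (intro card_inj_on_le[of h]) auto
    moreover have "real (card T) * (cmin * \<eta>) powr s \<le> 1"
    proof -
      have "real (card T) * (cmin * \<eta>) powr s = (\<Sum>v\<in>T. (cmin * \<eta>) powr s)" by simp
      also have "\<dots> \<le> (\<Sum>v\<in>T. ratio c v powr s)"
        using T(3) cmin_pos \<eta> s_nonneg by (intro sum_mono powr_mono2) auto
      also have "\<dots> = 1"
        unfolding T_def using n by (rule sum_ratio_powr_stop)
      finally show ?thesis .
    qed
    ultimately have "real (card C) * (cmin * \<eta>) powr s \<le> 1"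
      by (meson mult_right_mono of_nat_mono order_trans powr_ge_zero)
    then have "real (card C) \<le> (cmin * \<eta>) powr - s"
      using cmin_pos \<eta> by (simp add: powr_minus divide_simps)
    also have "(cmin * \<eta>) powr - s = ((cmin * 2 / D) * \<delta>) powr - s"
      by (simp add: \<eta>_def mult_ac)
    also have "\<dots> = (cmin * 2 / D) powr - s * \<delta> powr - s"
      by (rule powr_mult)
    finally show ?thesis .
  qed
  moreover have "(cmin * 2 / D) powr - s > 0" "D / 2 > 0" using D cmin_pos by auto
  ultimately show ?thesis by blast
qed

text \<open>The lower bound holds because the balls of radius \<open>2 * \<delta>\<close> about the centres of a maximal packing cover
  \<open>K\<close>, and the cost of a finite covering at exponent \<open>s\<close> is bounded below.\<close>

lemma packing_number_bounds:
  "\<exists>A>0. \<exists>B>0. \<forall>\<^sub>F \<delta> in at_right 0. \<exists>m. packing_number \<delta> K = of_nat m \<and>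
    A * \<delta> powr - s \<le> real m \<and> real m \<le> B * \<delta> powr - s"
proof -
  obtain B \<delta>0 where B: "B > 0" "\<delta>0 > 0" and upper:
    "\<And>\<delta> C. 0 < \<delta> \<Longrightarrow> \<delta> \<le> \<delta>0 \<Longrightarrow> is_packing \<delta> K C \<Longrightarrow> real (card C) \<le> B * \<delta> powr - s"
    using packing_upper_bound by blast
  obtain N where N: "N > 0" and bound:
    "\<forall>(J :: 'a set) d U. finite J \<longrightarrow> K \<subseteq> (\<Union>j\<in>J. U j) \<longrightarrow> (\<forall>j\<in>J. d j > 0) \<longrightarrow>
      (\<forall>j\<in>J. \<forall>a\<in>U j. \<forall>b\<in>U j. dist a b \<le> d j) \<longrightarrow> 1 \<le> N * (\<Sum>j\<in>J. d j powr s)"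
    using finite_cover_bound by blast
  define A where "A = 4 powr - s / N"
  have "\<exists>m. packing_number \<delta> K = of_nat m \<and> A * \<delta> powr - s \<le> real m \<and> real m \<le> B * \<delta> powr - s"
    if \<delta>: "0 < \<delta>" "\<delta> < \<delta>0" for \<delta>
  proof -
    have "card C \<le> nat \<lceil>B * \<delta> powr - s\<rceil>" if "is_packing \<delta> K C" for C
      using upper[OF \<delta>(1) _ that] \<delta>(2) by linarith
    then obtain C where C: "is_packing \<delta> K C" "packing_number \<delta> K = of_nat (card C)"
        "K \<subseteq> (\<Union>x\<in>C. cball x (2 * \<delta>))"
      using maximal_packing[of \<delta> K] \<delta>(1) less_imp_le[OF \<delta>(1)] by blast
    have "dist a b \<le> 4 * \<delta>" if "a \<in> cball x (2 * \<delta>)" "b \<in> cball x (2 * \<delta>)" for a b x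
      using that dist_triangle[of a b x] by (simp add: dist_commute)
    then have "1 \<le> N * (\<Sum>x\<in>C. (4 * \<delta>) powr s)"
      using bound[rule_format, of C "\<lambda>x. cball x (2 * \<delta>)" "\<lambda>x. 4 * \<delta>"] C(1,3) \<delta>(1)
      by (auto simp: is_packing_def)
    then have "1 \<le> N * real (card C) * (4 powr s * \<delta> powr s)"
      using \<delta>(1) by (simp add: powr_mult)
    then have "A * \<delta> powr - s \<le> real (card C)"
      using N \<delta>(1) by (simp add: A_def powr_minus divide_simps mult_ac)
    moreover have "real (card C) \<le> B * \<delta> powr - s"
      using upper[OF \<delta>(1) _ C(1)] \<delta>(2) by simp
    ultimately show ?thesis using C(2) by blast
  qed
  then have "\<forall>\<^sub>F \<delta> in at_right 0. \<exists>m. packing_number \<delta> K = of_nat m \<and>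
      A * \<delta> powr - s \<le> real m \<and> real m \<le> B * \<delta> powr - s"
    using B(2) by (auto simp: eventually_at_right_field)
  moreover have "A > 0" using N by (simp add: A_def)
  ultimately show ?thesis using B(1) by blast
qed

lemma box_dim: "has_box_dim K (ereal s)"
proof -
  obtain A B where AB: "A > 0" "B > 0" and ev:
    "\<forall>\<^sub>F \<delta> in at_right 0. \<exists>m. packing_number \<delta> K = of_nat m \<and>
      A * \<delta> powr - s \<le> real m \<and> real m \<le> B * \<delta> powr - s"
    using packing_number_bounds by blast
  define q where "q \<delta> = ln (enn2real (packing_number \<delta> K)) / (- ln \<delta>)" for \<delta>
  have small: "\<forall>\<^sub>F \<delta> :: real in at_right 0. 0 < \<delta> \<and> \<delta> < 1"
    by (auto simp: eventually_at_right_field intro!: exI[of _ 1])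
  have main: "\<forall>\<^sub>F \<delta> in at_right 0. eln (packing_number \<delta> K) / ereal (- ln \<delta>) = ereal (q \<delta>) \<and>
      s + ln A / (- ln \<delta>) \<le> q \<delta> \<and> q \<delta> \<le> s + ln B / (- ln \<delta>)"
    using ev small
  proof eventually_elim
    case (elim \<delta>)
    then obtain m where m: "packing_number \<delta> K = of_nat m" "A * \<delta> powr - s \<le> real m"
      "real m \<le> B * \<delta> powr - s" and \<delta>: "0 < \<delta>" "\<delta> < 1" by blast
    have "0 < A * \<delta> powr - s" using AB \<delta> by simp
    then have m0: "0 < real m" using m(2) by linarith
    have q: "q \<delta> = ln (real m) / (- ln \<delta>)"
      by (simp add: q_def m(1) flip: ennreal_of_nat_eq_real_of_nat)
    have ln: "- ln \<delta> > 0" using \<delta> by simp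
    have "ln (A * \<delta> powr - s) \<le> ln (real m)" "ln (real m) \<le> ln (B * \<delta> powr - s)"
      using m m0 AB \<delta> by simp_all
    then have "ln A + s * (- ln \<delta>) \<le> ln (real m)" "ln (real m) \<le> ln B + s * (- ln \<delta>)"
      using AB \<delta> by (simp_all add: ln_mult ln_powr)
    then have "(ln A + s * (- ln \<delta>)) / (- ln \<delta>) \<le> q \<delta>" "q \<delta> \<le> (ln B + s * (- ln \<delta>)) / (- ln \<delta>)"
      unfolding q using ln by (intro divide_right_mono; simp)+
    moreover have "(b + s * (- ln \<delta>)) / (- ln \<delta>) = s + b / (- ln \<delta>)" for b
      using ln by (simp add: field_simps)
    ultimately have "s + ln A / (- ln \<delta>) \<le> q \<delta>" "q \<delta> \<le> s + ln B / (- ln \<delta>)"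
      by simp_all
    moreover have "eln (packing_number \<delta> K) = ereal (ln (real m))"
      using m0 by (simp add: m(1) eln_of_nat)
    ultimately show ?case using ln by (simp add: q)
  qed
  have lim: "((\<lambda>\<delta>. s + b / (- ln \<delta>)) \<longlongrightarrow> s) (at_right 0)" for b :: real
  proof -
    have "filterlim (\<lambda>\<delta>::real. - ln \<delta>) at_top (at_right 0)"
      using ln_at_0 by (simp add: filterlim_uminus_at_bot)
    then have "((\<lambda>\<delta>. b / (- ln \<delta>)) \<longlongrightarrow> 0) (at_right 0)"
      by (intro tendsto_divide_0[OF tendsto_const] filterlim_at_top_imp_at_infinity)
    then show ?thesis using tendsto_add[OF tendsto_const[of s]] by fastforce
  qed
  have "(q \<longlongrightarrow> s) (at_right 0)"
    by (rule tendsto_sandwich[OF _ _ lim[of "ln A"] lim[of "ln B"]])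
       (use main in \<open>auto elim: eventually_mono\<close>)
  then have "((\<lambda>\<delta>. ereal (q \<delta>)) \<longlongrightarrow> ereal s) (at_right 0)"
    by simp
  moreover have "\<forall>\<^sub>F \<delta> in at_right 0. ereal (q \<delta>) = eln (packing_number \<delta> K) / ereal (- ln \<delta>)"
    using main by (rule eventually_mono) simp
  ultimately show ?thesis
    unfolding has_box_dim_def by (rule Lim_transform_eventually)
qed

end

section \<open>The measures of the natural fractal structure\<close>

lemma diameter_similarity_image:
  assumes "similarity a g" "compact X" "X \<noteq> {}"
  shows "diameter (g ` X) = a * diameter X"
proof (rule antisym)
  have a: "a > 0" and g: "\<And>x y. dist (g x) (g y) = a * dist x y"
    using assms(1) by (auto simp: similarity_def)
  have bX: "bounded X" using assms(2) by (rule compact_imp_bounded)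
  have le: "dist (g x) (g y) \<le> a * diameter X" if "x \<in> X" "y \<in> X" for x y
    using a diameter_bounded_bound[OF bX that] by (simp add: g)
  have "bounded (g ` X)"
    using le by (auto simp: bounded_two_points)
  obtain x y where "x \<in> X" "y \<in> X" "dist x y = diameter X"
    using diameter_compact_attained[OF assms(2,3)] by blast
  then show "a * diameter X \<le> diameter (g ` X)"
    using diameter_bounded_bound[OF \<open>bounded (g ` X)\<close>, of "g x" "g y"] by (simp add: g)
  show "diameter (g ` X) \<le> a * diameter X"
    unfolding diameter_def using le assms(3)
    by (auto intro!: cSUP_least simp: diameter_def)
qed

context ifs
begin

abbreviation natural_levels where "natural_levels \<equiv> natural_structure I f K"

lemma hitting_natural_levels: "hitting natural_levels n K = words I n"
  using word_map_image_K K_nonempty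
  by (fastforce simp: hitting_def natural_structure_def words_def)

lemma ediam_word: "set w \<subseteq> I \<Longrightarrow> ediam (word_map f w ` K) = ennreal (ratio c w * diameter K)"
proof -
  assume w: "set w \<subseteq> I"
  have "bounded (word_map f w ` K)"
    using word_map_image_K[OF w] K_bounded by (rule bounded_subset[rotated])
  then show ?thesis
    using diameter_similarity_image[OF similarity_word_map[OF w] K_compact K_nonempty]
    by (simp add: ediam_def)
qed

text \<open>The diameters of the sets of a level are multiplicative along words, so their powers sum up to a power.\<close>

lemma frac_pre3_eq:
  "frac_pre3 natural_levels n t K = (INF l\<in>{n..}. ennreal ((\<Sum>i\<in>I. c i powr t) ^ l) * epower (ennreal (diameter K)) t)"
proof -
  have "(\<Sum>\<^sub>\<infinity>w\<in>hitting natural_levels l K. epower (ediam (snd (natural_levels l) w)) t)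
      = ennreal ((\<Sum>i\<in>I. c i powr t) ^ l) * epower (ennreal (diameter K)) t" for l
  proof -
    have "(\<Sum>\<^sub>\<infinity>w\<in>hitting natural_levels l K. epower (ediam (snd (natural_levels l) w)) t)
        = (\<Sum>w\<in>words I l. epower (ediam (word_map f w ` K)) t)"
      by (simp add: hitting_natural_levels finite_words) (simp add: natural_structure_def)
    also have "\<dots> = (\<Sum>w\<in>words I l. ennreal (ratio c w powr t) * epower (ennreal (diameter K)) t)"
      using diameter_ge_0[OF K_bounded] ratio_pos
      by (intro sum.cong) (auto simp: words_def ediam_word epower_mult_ennreal simp del: ennreal_mult')
    also have "\<dots> = ennreal (\<Sum>w\<in>words I l. ratio c w powr t) * epower (ennreal (diameter K)) t"
      by (simp add: sum_ennreal flip: sum_distrib_right)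
    finally show ?thesis by (simp add: sum_ratio_powr)
  qed
  then show ?thesis by (simp add: frac_pre3_def)
qed

lemma epower_diameter_finite: "epower (ennreal (diameter K)) t < \<infinity>"
  by (simp add: epower_def)

lemma measures_chain:
  "hausdorff_meas t K \<le> frac_meas6 natural_levels t K" "frac_meas6 natural_levels t K \<le> frac_meas5 natural_levels t K"
  "frac_meas5 natural_levels t K \<le> frac_meas4 natural_levels t K" "frac_meas4 natural_levels t K \<le> frac_meas3 natural_levels t K"
proof -
  show "hausdorff_meas t K \<le> frac_meas6 natural_levels t K" by (rule hausdorff_meas_le_frac_meas6)
  show "frac_meas5 natural_levels t K \<le> frac_meas4 natural_levels t K" by (rule frac_meas5_le_frac_meas4)
  show "frac_meas6 natural_levels t K \<le> frac_meas5 natural_levels t K"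
  proof (rule frac_meas6_le_frac_meas5)
    show "(\<lambda>n. level_diam natural_levels n K) \<longlonglongrightarrow> 0"
      using level_diam_natural_structure_tendsto_0(2)[OF finite_I _ attractor, of c]
        contractive_similarity by blast
    show "A \<noteq> {} \<and> A \<subseteq> K" if "A \<in> level_sets natural_levels n" for n A
      using that K_nonempty word_map_image_K by (auto simp: level_sets_natural_structure)
  qed
  show "frac_meas4 natural_levels t K \<le> frac_meas3 natural_levels t K"
  proof (rule frac_meas4_le_frac_meas3)
    show "finite (fst (natural_levels n))" for n
      using finite_words[of n] by (simp add: natural_structure_def words_def)
    show "K \<subseteq> \<Union>(level_sets natural_levels n)" for n
      using fractal_structure_natural_structure[OF attractor] by (simp add: fractal_structure_def)
  qed
qed

end

context osc_ifs
begin

lemma frac_meas3_finite: "frac_meas3 natural_levels s K < \<infinity>"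
proof -
  have "frac_pre3 natural_levels n s K \<le> epower (ennreal (diameter K)) s" for n
    unfolding frac_pre3_eq by (rule INF_lower2[of n]) (auto simp: moran)
  then have "frac_meas3 natural_levels s K \<le> epower (ennreal (diameter K)) s"
    unfolding frac_meas3_eq_SUP by (intro SUP_least)
  then show ?thesis using epower_diameter_finite by (rule le_less_trans)
qed

lemma frac_meas3_zero_above:
  assumes "s < t"
  shows "frac_meas3 natural_levels t K = 0"
proof -
  define q where "q = (\<Sum>i\<in>I. c i powr t)"
  have "q < (\<Sum>i\<in>I. c i powr s)"
    unfolding q_def using finite_I I_nonempty contractive_similarity assms
    by (intro sum_strict_mono powr_less_mono') auto
  then have q: "0 \<le> q" "q < 1" by (auto simp: moran q_def intro: sum_nonneg)
  have "(\<lambda>l. ennreal (q ^ l)) \<longlonglongrightarrow> ennreal 0"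
    using q by (intro tendsto_ennrealI LIMSEQ_realpow_zero)
  then have "(\<lambda>l. epower (ennreal (diameter K)) t * ennreal (q ^ l))
      \<longlonglongrightarrow> epower (ennreal (diameter K)) t * ennreal 0"
    using epower_diameter_finite[of t] by (intro ennreal_tendsto_cmult) auto
  then have lim: "(\<lambda>l. ennreal (q ^ l) * epower (ennreal (diameter K)) t) \<longlonglongrightarrow> 0"
    by (simp add: mult.commute)
  have "frac_pre3 natural_levels n t K \<le> 0" for n
    unfolding frac_pre3_eq q_def[symmetric]
    by (rule tendsto_lowerbound[OF lim])
       (auto simp: eventually_sequentially intro!: exI[of _ n] INF_lower)
  then show ?thesis unfolding frac_meas3_eq_SUP by simp
qed

text \<open>Every measure between the Hausdorff measure and the measure of type III vanishes above \<open>s\<close> with the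
  latter and is infinite below \<open>s\<close> with the former.\<close>

lemma intermediate_measure:
  assumes "\<And>t. hausdorff_meas t K \<le> H t" "\<And>t. H t \<le> frac_meas3 natural_levels t K"
  shows "critical_exponent H (ereal s)" "H s \<in> {0<..<\<infinity>}"
proof -
  show "critical_exponent H (ereal s)"
  proof (rule critical_exponentI[OF s_nonneg])
    show "H t = 0" if "s < t" for t
      using assms(2)[of t] frac_meas3_zero_above[OF that] by simp
    show "H t = \<infinity>" if "0 \<le> t" "t < s" for t
      using assms(1)[of t] hausdorff_meas_infinite_below[OF hausdorff_meas_pos that]
      by (simp add: top_unique)
  qed
  show "H s \<in> {0<..<\<infinity>}"
    using assms[of s] hausdorff_meas_pos frac_meas3_finite by (auto intro: less_le_trans le_less_trans)
qed

lemma measure_dimensions: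
  "has_hausdorff_dim K (ereal s)" "hausdorff_meas s K \<in> {0<..<\<infinity>}"
  "has_fractal_dim3 natural_levels K (ereal s)" "frac_meas3 natural_levels s K \<in> {0<..<\<infinity>}"
  "has_fractal_dim4 natural_levels K (ereal s)" "frac_meas4 natural_levels s K \<in> {0<..<\<infinity>}"
  "has_fractal_dim5 natural_levels K (ereal s)" "frac_meas5 natural_levels s K \<in> {0<..<\<infinity>}"
  "has_fractal_dim6 natural_levels K (ereal s)" "frac_meas6 natural_levels s K \<in> {0<..<\<infinity>}"
  unfolding has_hausdorff_dim_def has_fractal_dim3_def has_fractal_dim4_def has_fractal_dim5_def
    has_fractal_dim6_def
  by (rule intermediate_measure; use measures_chain in \<open>blast intro: order_trans\<close>)+

end

section \<open>Fractal dimensions I and II\<close>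

context osc_ifs
begin

lemma eln_ecount_hitting: "eln (ecount (hitting natural_levels n K)) = ereal (real n * ln (real (card I)))"
proof -
  have "card (words I n) = card I ^ n"
    unfolding words_def by (rule card_lists_length_eq[OF finite_I])
  moreover have "card I > 0" using finite_I I_nonempty by (simp add: card_gt_0_iff)
  ultimately show ?thesis
    using eln_of_nat[of "card I ^ n"]
    by (simp add: ecount_def hitting_natural_levels finite_words ln_realpow del: of_nat_power)
      (simp add: ln_realpow)
qed

lemma fractal_dim1: "has_fractal_dim1 natural_levels K (ereal (ln (real (card I)) / ln 2))"
proof -
  have "\<forall>\<^sub>F n in sequentially. eln (ecount (hitting natural_levels n K)) / ereal (real n * ln 2)
      = ereal (ln (real (card I)) / ln 2)"
    using eventually_gt_at_top[of 0] by eventually_elim (simp add: eln_ecount_hitting)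
  then show ?thesis
    unfolding has_fractal_dim1_def by (rule tendsto_eventually)
qed

text \<open>If \<open>K\<close> were a single point and \<open>s > 0\<close>, all its coverings by level sets would cost nothing,
  contrary to the positivity of the measure. For \<open>s = 0\<close>, a single point does occur.\<close>

lemma diameter_pos:
  assumes "s > 0"
  shows "diameter K > 0"
proof (rule ccontr)
  assume "\<not> diameter K > 0"
  then have "diameter K = 0" using diameter_ge_0[OF K_bounded] by simp
  then have "frac_pre3 natural_levels n s K = 0" for n
    using assms by (simp add: frac_pre3_eq moran epower_def)
  then have "frac_meas3 natural_levels s K = 0" by (simp add: frac_meas3_eq_SUP)
  then show False using measure_dimensions(4) by simp
qed

context
  fixes r :: real
  assumes r: "0 < r" "r < 1" and equal_ratios: "\<And>i. i \<in> I \<Longrightarrow> c i = r"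
begin

lemma ln_card_I: "ln (real (card I)) = - s * ln r"
proof -
  have "real (card I) * r powr s = 1"
    using moran by (simp add: equal_ratios cong: sum.cong)
  then have "real (card I) = r powr - s"
    using r by (simp add: powr_minus field_simps)
  then show ?thesis using r by (simp add: ln_powr)
qed

lemma level_diam_equal_ratios: "level_diam natural_levels n K = ennreal (r ^ n * diameter K)"
proof -
  have "ratio c w = r ^ n" if "w \<in> words I n" for w
  proof -
    have "set w \<subseteq> I \<Longrightarrow> ratio c w = r ^ length w"
      by (induction w) (auto simp: equal_ratios)
    then show ?thesis using that by (simp add: words_def)
  qed
  then have "ediam (snd (natural_levels n) w) = ennreal (r ^ n * diameter K)" if "w \<in> words I n" for w
    using that ediam_word[of w] by (simp add: natural_structure_def words_def)
  moreover have "words I n \<noteq> {}"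
    using K_eq_Union_words[of n] K_nonempty by auto
  ultimately show ?thesis
    unfolding level_diam_def hitting_natural_levels by simp
qed

lemma fractal_dim2: "has_fractal_dim2 natural_levels K (ereal s)"
proof (cases "s = 0")
  case True
  then show ?thesis
    by (simp add: has_fractal_dim2_def eln_ecount_hitting ln_card_I zero_ereal_def[symmetric])
next
  case False
  then have D: "diameter K > 0" using diameter_pos s_nonneg by simp
  define L where "L = - ln r"
  define b where "b = ln (diameter K)"
  have L: "L > 0" using r by (simp add: L_def)
  have eln: "eln (level_diam natural_levels n K) = ereal (b - real n * L)" for n
    using r D by (simp add: level_diam_equal_ratios eln_def ln_mult ln_realpow L_def b_def)
  have lim: "(\<lambda>n. s * L / (L - b / real n)) \<longlonglongrightarrow> s"
  proof -
    have "(\<lambda>n. b / real n) \<longlonglongrightarrow> 0"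
      by (rule lim_const_over_n)
    then have "(\<lambda>n. s * L / (L - b / real n)) \<longlonglongrightarrow> s * L / (L - 0)"
      using L by (intro tendsto_intros) auto
    then show ?thesis using L by simp
  qed
  \<comment> \<open>For \<open>n \<ge> n0\<close>, \<open>r ^ n * diameter K < 1\<close>, so the denominator is positive.\<close>
  obtain n0 where n0: "b / L < real n0" using reals_Archimedean2 by blast
  have "\<forall>\<^sub>F n in sequentially. ereal (s * L / (L - b / real n))
      = eln (ecount (hitting natural_levels n K)) / - eln (level_diam natural_levels n K)"
    using eventually_ge_at_top[of n0] eventually_gt_at_top[of 0]
  proof eventually_elim
    case (elim n)
    have "b / L < real n" using n0 elim by linarith
    then have "real n * L - b > 0" using L by (simp add: field_simps)
    moreover have "s * L / (L - b / real n) = real n * (s * L) / (real n * L - b)"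
      using elim by (simp add: field_simps)
    ultimately show ?case
      by (simp add: eln eln_ecount_hitting ln_card_I) (simp add: L_def)
  qed
  moreover have "(\<lambda>n. ereal (s * L / (L - b / real n))) \<longlonglongrightarrow> ereal s"
    using lim by simp
  ultimately show ?thesis
    unfolding has_fractal_dim2_def by (rule Lim_transform_eventually[rotated])
qed

end

end

theorem theorem3p4:
  fixes k :: nat
    and f :: "nat \<Rightarrow> 'a::euclidean_space \<Rightarrow> 'a"
    and c :: "nat \<Rightarrow> real"
    and K :: "'a set"
    and \<Gamma> :: "(nat list, 'a) levels"
    and s :: real
  assumes "\<forall>i\<in>{1..k}. 0 < c i \<and> c i < 1 \<and> similarity (c i) (f i)"
    and "open_set_condition {1..k} f"
    and "is_attractor {1..k} f K"
    and "\<Gamma> = natural_structure {1..k} f K"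
    and "(\<Sum>i\<in>{1..k}. c i powr s) = 1"
  shows
    "(has_box_dim K (ereal s) \<and> has_fractal_dim3 \<Gamma> K (ereal s) \<and>
      has_fractal_dim4 \<Gamma> K (ereal s) \<and> has_fractal_dim5 \<Gamma> K (ereal s) \<and>
      has_fractal_dim6 \<Gamma> K (ereal s) \<and> has_hausdorff_dim K (ereal s)) \<and>
     (\<forall>r. r \<in> {0<..<1} \<and> (\<forall>i\<in>{1..k}. c i = r) \<longrightarrow>
       (\<exists>d D. has_box_dim K d \<and> has_fractal_dim2 \<Gamma> K d \<and> has_fractal_dim3 \<Gamma> K d \<and>
          has_fractal_dim4 \<Gamma> K d \<and> has_fractal_dim5 \<Gamma> K d \<and> has_fractal_dim6 \<Gamma> K d \<and>
          has_hausdorff_dim K d \<and>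
          has_fractal_dim1 \<Gamma> K D \<and> d \<le> ereal (- ln 2 / ln r) * D)) \<and>
     hausdorff_meas s K \<in> {0<..<\<infinity>} \<and>
     frac_meas3 \<Gamma> s K \<in> {0<..<\<infinity>} \<and> frac_meas4 \<Gamma> s K \<in> {0<..<\<infinity>} \<and>
     frac_meas5 \<Gamma> s K \<in> {0<..<\<infinity>} \<and> frac_meas6 \<Gamma> s K \<in> {0<..<\<infinity>}"
proof -
  interpret osc_ifs "{1..k}" f c K s
    using assms by unfold_locales auto
  have "\<exists>d D. has_box_dim K d \<and> has_fractal_dim2 \<Gamma> K d \<and> has_fractal_dim3 \<Gamma> K d \<and>
      has_fractal_dim4 \<Gamma> K d \<and> has_fractal_dim5 \<Gamma> K d \<and> has_fractal_dim6 \<Gamma> K d \<and>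
      has_hausdorff_dim K d \<and> has_fractal_dim1 \<Gamma> K D \<and> d \<le> ereal (- ln 2 / ln r) * D"
    if r: "r \<in> {0<..<1} \<and> (\<forall>i\<in>{1..k}. c i = r)" for r
  proof -
    have "ereal s \<le> ereal (- ln 2 / ln r) * ereal (ln (real (card {1..k})) / ln 2)"
      using r ln_card_I[of r] by (simp del: card_atLeastAtMost)
    moreover have "has_fractal_dim2 \<Gamma> K (ereal s)"
      unfolding assms(4) using r by (intro fractal_dim2[of r]) auto
    ultimately show ?thesis
      using box_dim measure_dimensions fractal_dim1 unfolding assms(4) by blast
  qed
  then show ?thesis
    using box_dim measure_dimensions unfolding assms(4) by blast
qed

end
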